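(* Let $d\ge1$. Suppose that, for some $1\leq q_1,q_2,r_1,r_2\leq\infty$, $C>0$, the following estimate holds: $$\|e^{it\Delta}u_0\|_{W(L^{q_1},L^{q_2})_tW(L^{r_1},L^{r_2})_x}\leq C\|u_0\|_{L^2}\quad\text{for all }u_0\in\mathcal S(\mathbb R^d).$$ Then $$\frac2{q_1}+\frac d{r_1}\geq\frac d2\qquad\text{and}\qquad\frac2{q_2}+\frac d{r_2}\leq\frac d2.$$ In particular $r_2\geq2$. Finally, $q_2\geq2$.
   Context: $1/\infty=0$. $e^{it\Delta}$ is the Schr\"odinger propagator on $\mathbb R^d$ (solution operator of $i\partial_tu+\Delta u=0$), i.e. the Fourier multiplier with symbol $e^{-4\pi^2it|\xi|^2}$, where $\hat f(\xi)=\int f(x)e^{-2\pi ix\xi}dx$. Wiener amalgam spaces on $\mathbb R^n$: fix a window $g\in C_0^\infty(\mathbb R^n)$ with $\|g\|_{L^2}=1$ and let $T_yg(x)=g(x-y)$. $W(L^p,L^q)$ is the space of functions $f$ locally in $L^p$ with $\|f\|_{W(L^p,L^q)}=\big\|y\mapsto\|f\,T_yg\|_{L^p}\big\|_{L^q}<\infty$. Different windows give equivalent norms. The mixed norm is $$\|F\|_{W(L^{q_1},L^{q_2})_tW(L^{r_1},L^{r_2})_x}=\big\|\,\|F(t,\cdot)\|_{W(L^{r_1},L^{r_2})(\mathbb R^d)}\big\|_{W(L^{q_1},L^{q_2})(\mathbb R)}.$$ *)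

theory Defs
  imports "HOL-Analysis.Analysis" "HOL-Probability.Essential_Supremum"
begin

primrec iter_deriv :: "'a::euclidean_space list \<Rightarrow> ('a \<Rightarrow> complex) \<Rightarrow> 'a \<Rightarrow> complex" where
  "iter_deriv [] f = f"
| "iter_deriv (v # vs) f = (\<lambda>x. frechet_derivative (iter_deriv vs f) (at x) v)"

(* All iterated partial derivatives exist and are (Frechet) differentiable, hence
   continuous; this is C^infinity. *)
definition smooth :: "('a::euclidean_space \<Rightarrow> complex) \<Rightarrow> bool" where
  "smooth f \<longleftrightarrow> (\<forall>vs. set vs \<subseteq> Basis \<longrightarrow> iter_deriv vs f differentiable_on UNIV)"

definition test_function :: "('a::euclidean_space \<Rightarrow> complex) \<Rightarrow> bool" where
  "test_function g \<longleftrightarrow> smooth g \<and> compact (closure {x. g x \<noteq> 0})"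

definition schwartz :: "('a::euclidean_space \<Rightarrow> complex) \<Rightarrow> bool" where
  "schwartz f \<longleftrightarrow> smooth f \<and>
     (\<forall>(k::nat) vs. set vs \<subseteq> Basis \<longrightarrow> (\<exists>B. \<forall>x. norm x ^ k * norm (iter_deriv vs f x) \<le> B))"

definition fourier :: "('a::euclidean_space \<Rightarrow> complex) \<Rightarrow> 'a \<Rightarrow> complex" where
  "fourier f \<xi> = (LINT x|lborel. f x * cis (- (2 * pi * (x \<bullet> \<xi>))))"

(* The Fourier multiplier with symbol exp (-4 pi^2 i t |xi|^2), followed by the inverse
   Fourier transform. *)
definition schroedinger :: "real \<Rightarrow> ('a::euclidean_space \<Rightarrow> complex) \<Rightarrow> 'a \<Rightarrow> complex" where
  "schroedinger t f x =
     (LINT \<xi>|lborel. cis (2 * pi * (x \<bullet> \<xi>)) *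
        (cis (- (4 * pi\<^sup>2 * t * (norm \<xi>)\<^sup>2)) * fourier f \<xi>))"

(* Only used with exponents a > 0. *)
definition ennreal_powr :: "ennreal \<Rightarrow> real \<Rightarrow> ennreal" where
  "ennreal_powr x a = (if x = \<infinity> then \<infinity> else ennreal (enn2real x powr a))"

(* Norms are taken of [0,\<infinity>]-valued functions, so that they can be iterated (an inner norm
   may be infinite); for a complex-valued f they are applied to the modulus of f. *)
definition Lp_norm :: "ennreal \<Rightarrow> ('a::euclidean_space \<Rightarrow> ennreal) \<Rightarrow> ennreal" where
  "Lp_norm p F =
     (if p = \<infinity> then esssup lborel F
      else ennreal_powr (\<integral>\<^sup>+ x. ennreal_powr (F x) (enn2real p) \<partial>lborel) (1 / enn2real p))"

(* The norm of W(L^p, L^q) with window g; F stands for the modulus of the function measured,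
   and |f T_y g| = |f| |T_y g|. *)
definition amalgam_norm ::
  "ennreal \<Rightarrow> ennreal \<Rightarrow> ('a::euclidean_space \<Rightarrow> complex) \<Rightarrow> ('a \<Rightarrow> ennreal) \<Rightarrow> ennreal" where
  "amalgam_norm p q g F =
     Lp_norm q (\<lambda>y. Lp_norm p (\<lambda>x. F x * ennreal (norm (g (x - y)))))"

definition window :: "('a::euclidean_space \<Rightarrow> complex) \<Rightarrow> bool" where
  "window g \<longleftrightarrow> test_function g \<and> Lp_norm 2 (\<lambda>x. ennreal (norm (g x))) = 1"

(* The norm of W(L^{q1}, L^{q2})_t W(L^{r1}, L^{r2})_x, with window h in time and g in space. *)
definition mixed_amalgam_norm ::
  "ennreal \<Rightarrow> ennreal \<Rightarrow> (real \<Rightarrow> complex) \<Rightarrow> ennreal \<Rightarrow> ennreal \<Rightarrow>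
   ('a::euclidean_space \<Rightarrow> complex) \<Rightarrow> (real \<Rightarrow> 'a \<Rightarrow> complex) \<Rightarrow> ennreal" where
  "mixed_amalgam_norm q1 q2 h r1 r2 g F =
     amalgam_norm q1 q2 h (\<lambda>t. amalgam_norm r1 r2 g (\<lambda>x. ennreal (norm (F t x))))"

end

theory Submission
  imports Defs "HOL-Complex_Analysis.Complex_Analysis" "HOL-Probability.Distributions"
begin

text \<open>
  The estimate is tested on Gaussian wave packets. The packet with parameter \<open>z\<close>, \<open>Re z > 0\<close>, is
  \<open>exp (- \<bar>x\<bar>\<^sup>2 / z)\<close>, normalised so that its Fourier transform is \<open>exp (- pi\<^sup>2 z \<bar>\<xi>\<bar>\<^sup>2)\<close>. The
  Schroedinger flow replaces \<open>z\<close> by \<open>z + 4 i t\<close>, so that the evolution, the size and the inner products of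
  packets are all Gaussian integrals with a complex coefficient \<open>b\<close>. They are controlled by
  \<open>(pi / \<bar>b\<bar>) powr (d / 2)\<close>, the modulus of the integral of \<open>exp (- b \<bar>x\<bar>\<^sup>2)\<close>
  (\<open>norm_gaussian_integral\<close>, \<open>gaussian_laplace_transform\<close>), which follows from the case of real \<open>b\<close> by
  analytic continuation.

  A packet of width \<open>r\<close> (\<open>z = r\<^sup>2\<close>) stays of size \<open>r powr (- d)\<close> on \<open>\<bar>x\<bar> \<le> r\<close>, \<open>\<bar>t\<bar> \<le> r\<^sup>2\<close>
  (\<open>packet_focused\<close>), while its norm in \<open>L\<^sup>2\<close> is of order \<open>r powr (- d / 2)\<close>. Small \<open>r\<close>
  is seen by the local exponents of the amalgam norm and large \<open>r\<close> by the global ones, so the estimate gives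
  \<open>r powr (2 / q1 + d / r1 - d) \<lesssim> r powr (- d / 2)\<close> as \<open>r \<rightarrow> 0\<close> and
  \<open>r powr (2 / q2 + d / r2 - d) \<lesssim> r powr (- d / 2)\<close> as \<open>r \<rightarrow> \<infinity>\<close> (\<open>one_packet_test\<close>). These are the two
  conditions on the exponents, and the second one contains \<open>r2 \<ge> 2\<close>.

  For \<open>q2 \<ge> 2\<close> the datum is a sum of \<open>N\<close> packets of width 1 that focus at \<open>N\<close> times very far apart
  (\<open>packets_refocusing\<close>). Dispersion makes them almost orthogonal, so that the norm of the sum is
  \<open>O(sqrt N)\<close>, and keeps the unfocused packets negligible near the focusing time of another. The solution is
  therefore bounded below near each of the \<open>N\<close> times, whence \<open>N powr (1 / q2) \<lesssim> N powr (1 / 2)\<close>.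
\<close>

section \<open>Laplace transforms and Gaussian integrals\<close>

text \<open>
  Differentiation under the integral sign. On the disc of radius \<open>d\<close> about \<open>z0\<close> the
  derivative \<open>p exp (z p) h\<close> is dominated by the integrands at the two real translates
  \<open>z0 \<plusminus> 2d\<close>: one margin \<open>d\<close> pays for moving \<open>z\<close>, the other for the factor \<open>p\<close>, because
  \<open>d \<bar>p\<bar> \<le> exp (d \<bar>p\<bar>)\<close>.
\<close>

lemma laplace_transform_holomorphic:
  fixes p :: "'a \<Rightarrow> real" and h :: "'a \<Rightarrow> complex"
  assumes S: "open S" and [measurable]: "p \<in> borel_measurable M" "h \<in> borel_measurable M"
    and int: "\<And>z. z \<in> S \<Longrightarrow> integrable M (\<lambda>x. exp (z * of_real (p x)) * h x)"
  shows "(\<lambda>z. LINT x|M. exp (z * of_real (p x)) * h x) holomorphic_on S"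
proof -
  define E where "E z x = exp (z * of_real (p x)) * h x" for z x
  have [measurable]: "E z \<in> borel_measurable M" for z
    unfolding E_def by measurable
  have intE: "integrable M (E z)" if "z \<in> S" for z
    using int[OF that] by (simp add: E_def[abs_def])
  have "\<exists>D. ((\<lambda>z. LINT x|M. E z x) has_field_derivative D) (at z0)" if z0: "z0 \<in> S" for z0
  proof -
    obtain e where e: "e > 0" "cball z0 e \<subseteq> S"
      using S z0 open_contains_cball by blast
    define d where "d = e / 2"
    have d: "d > 0" using e by (simp add: d_def)
    have pm: "z0 + of_real (2 * d) \<in> S" "z0 - of_real (2 * d) \<in> S"
      using e by (auto simp: d_def dist_norm intro!: subsetD[OF e(2)])
    define w where "w x = (norm (E (z0 + of_real (2 * d)) x) + norm (E (z0 - of_real (2 * d)) x)) / d" for x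
    have w: "integrable M w"
      unfolding w_def using intE[OF pm(1)] intE[OF pm(2)] by simp
    have deriv: "((\<lambda>z. E z x) has_field_derivative of_real (p x) * E z x) (at z within T)" for z x T
      unfolding E_def by (auto intro!: derivative_eq_intros)
    have bound: "norm (of_real (p x) * E z x) \<le> w x" if z: "z \<in> ball z0 d" for z x
    proof -
      have re: "\<bar>Re z - Re z0\<bar> \<le> d"
        using z abs_Re_le_cmod[of "z - z0"] by (simp add: dist_norm norm_minus_commute)
      have "(Re z - Re z0) * p x \<le> \<bar>Re z - Re z0\<bar> * \<bar>p x\<bar>"
        by (metis abs_ge_self abs_mult)
      also have "\<dots> \<le> d * \<bar>p x\<bar>" using re by (intro mult_right_mono) auto
      finally have 1: "Re z * p x \<le> Re z0 * p x + d * \<bar>p x\<bar>" by (simp add: algebra_simps)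
      have 2: "d * \<bar>p x\<bar> \<le> exp (d * \<bar>p x\<bar>)"
        using exp_ge_add_one_self[of "d * \<bar>p x\<bar>"] by linarith
      have "d * \<bar>p x\<bar> * exp (Re z * p x) \<le> exp (d * \<bar>p x\<bar>) * exp (Re z0 * p x + d * \<bar>p x\<bar>)"
        using 1 2 d by (intro mult_mono) auto
      also have "\<dots> = exp (Re z0 * p x + 2 * d * \<bar>p x\<bar>)"
        by (simp add: exp_add[symmetric])
      also have "\<dots> \<le> exp ((Re z0 + 2 * d) * p x) + exp ((Re z0 - 2 * d) * p x)"
        by (cases "p x \<ge> 0") (auto simp: algebra_simps add_increasing add_increasing2)
      finally have "d * \<bar>p x\<bar> * exp (Re z * p x) * norm (h x) \<le>
          (exp ((Re z0 + 2 * d) * p x) + exp ((Re z0 - 2 * d) * p x)) * norm (h x)"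
        by (intro mult_right_mono) auto
      then show ?thesis
        using d by (simp add: w_def E_def norm_mult field_simps)
    qed
    have quot: "norm ((E z x - E z0 x) / (z - z0)) \<le> w x" if z: "z \<in> ball z0 d - {z0}" for z x
    proof -
      have "norm (E z x - E z0 x) \<le> w x * norm (z - z0)"
        using z d by (intro field_differentiable_bound[of "ball z0 d" _ "\<lambda>z. of_real (p x) * E z x"] deriv bound) auto
      then show ?thesis using z by (auto simp: norm_divide divide_simps)
    qed
    have Sb: "z \<in> S" if "z \<in> ball z0 d" for z
      using that e d by (intro subsetD[OF e(2)]) (auto simp: d_def)
    have "((\<lambda>z. ((LINT x|M. E z x) - (LINT x|M. E z0 x)) / (z - z0)) \<longlongrightarrow>
        (LINT x|M. of_real (p x) * E z0 x)) (at z0 within ball z0 d)"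
      unfolding tendsto_at_iff_sequentially comp_def
    proof (intro allI impI)
      fix X :: "nat \<Rightarrow> complex" assume X: "\<forall>i. X i \<in> ball z0 d - {z0}" "X \<longlonglongrightarrow> z0"
      have "(\<lambda>i. LINT x|M. (E (X i) x - E z0 x) / (X i - z0)) \<longlonglongrightarrow> (LINT x|M. of_real (p x) * E z0 x)"
      proof (rule integral_dominated_convergence[where w = w])
        show "AE x in M. (\<lambda>i. (E (X i) x - E z0 x) / (X i - z0)) \<longlonglongrightarrow> of_real (p x) * E z0 x"
        proof (rule AE_I2)
          fix x
          show "(\<lambda>i. (E (X i) x - E z0 x) / (X i - z0)) \<longlonglongrightarrow> of_real (p x) * E z0 x"
            using deriv[of x z0 "ball z0 d"] X
            unfolding has_field_derivative_iff tendsto_at_iff_sequentially comp_def by blast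
        qed
      qed (use w X quot in auto)
      moreover have "(LINT x|M. (E (X i) x - E z0 x) / (X i - z0)) =
          ((LINT x|M. E (X i) x) - (LINT x|M. E z0 x)) / (X i - z0)" for i
        using X Sb z0 by (simp add: intE)
      ultimately show "(\<lambda>i. ((LINT x|M. E (X i) x) - (LINT x|M. E z0 x)) / (X i - z0))
          \<longlonglongrightarrow> (LINT x|M. of_real (p x) * E z0 x)" by (simp only:)
    qed
    then show ?thesis
      using d unfolding has_field_derivative_iff by (auto simp: at_within_open[of z0 "ball z0 d"])
  qed
  then show ?thesis
    using S unfolding E_def by (auto simp: holomorphic_on_open)
qed

lemma nn_integral_gaussian:
  assumes c: "c > 0"
  shows "(\<integral>\<^sup>+x. ennreal (exp (- c * (norm (x::'a::euclidean_space))\<^sup>2)) \<partial>lborel)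
         = ennreal ((pi / c) powr (DIM('a) / 2))"
proof -
  define s where "s = 1 / sqrt (2 * c)"
  have s: "s > 0" "s\<^sup>2 = 1 / (2 * c)" using c by (auto simp: s_def power_divide)
  have one: "(\<integral>\<^sup>+y. ennreal (exp (- c * y\<^sup>2)) \<partial>lborel) = ennreal (sqrt (pi / c))"
  proof -
    have "(\<integral>\<^sup>+y. ennreal (exp (- c * y\<^sup>2)) \<partial>lborel)
        = (\<integral>\<^sup>+y. ennreal (sqrt (pi / c)) * ennreal (normal_density 0 s y) \<partial>lborel)"
      using c by (intro nn_integral_cong)
        (simp add: ennreal_mult'[symmetric] normal_density_def s real_sqrt_divide field_simps)
    also have "\<dots> = ennreal (sqrt (pi / c)) * (\<integral>\<^sup>+y. ennreal (normal_density 0 s y) \<partial>lborel)"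
      by (rule nn_integral_cmult) auto
    also have "(\<integral>\<^sup>+y. ennreal (normal_density 0 s y) \<partial>lborel) = 1"
      using s by (subst nn_integral_eq_integral) auto
    finally show ?thesis by simp
  qed
  have "(\<integral>\<^sup>+x. ennreal (exp (- c * (norm (x::'a))\<^sup>2)) \<partial>lborel)
      = (\<integral>\<^sup>+x. (\<Prod>b\<in>Basis. ennreal (exp (- c * (x \<bullet> b)\<^sup>2))) \<partial>(lborel::'a measure))"
  proof (intro nn_integral_cong)
    fix x :: 'a
    have "exp (- c * (norm x)\<^sup>2) = exp (\<Sum>b\<in>Basis. - c * (x \<bullet> b)\<^sup>2)"
      unfolding norm_eq_sqrt_inner euclidean_inner[of x x]
      by (simp add: sum_nonneg sum_distrib_left power2_eq_square)
    also have "\<dots> = (\<Prod>b\<in>Basis. exp (- c * (x \<bullet> b)\<^sup>2))"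
      by (simp add: exp_sum)
    finally show "ennreal (exp (- c * (norm x)\<^sup>2)) = (\<Prod>b\<in>Basis. ennreal (exp (- c * (x \<bullet> b)\<^sup>2)))"
      by (simp add: prod_ennreal)
  qed
  also have "\<dots> = (\<Prod>b\<in>(Basis::'a set). \<integral>\<^sup>+y. ennreal (exp (- c * y\<^sup>2)) \<partial>lborel)"
    by (rule nn_integral_lborel_prod) auto
  also have "\<dots> = ennreal (sqrt (pi / c) ^ DIM('a))"
    unfolding one using c by (simp add: ennreal_power)
  also have "sqrt (pi / c) ^ DIM('a) = (pi / c) powr (DIM('a) / 2)"
    using c by (simp add: powr_half_sqrt[symmetric] powr_power powr_powr powr_realpow[symmetric])
  finally show ?thesis .
qed

text \<open>
  The dimension is passed as a type, since it cannot be read off the value.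
\<close>

definition gaussian_integral :: "'a::euclidean_space itself \<Rightarrow> complex \<Rightarrow> complex" where
  "gaussian_integral _ b = (LINT x|lborel. exp (- b * of_real ((norm (x::'a))\<^sup>2)))"

lemma gaussian_linear_integrable:
  fixes v :: "'a::euclidean_space"
  assumes b: "Re b > 0"
  shows "integrable lborel (\<lambda>x. exp (w * of_real (x \<bullet> v)) * exp (- b * of_real ((norm x)\<^sup>2)))"
proof -
  define \<beta> where "\<beta> = Re b"
  have \<beta>: "\<beta> > 0" using b by (simp add: \<beta>_def)
  define R where "R = \<bar>Re w\<bar> * norm v"
  have "integrable lborel (\<lambda>x::'a. exp (- (\<beta> / 2) * (norm x)\<^sup>2))"
    using \<beta> nn_integral_gaussian[of "\<beta> / 2", where 'a = 'a] by (intro integrableI_nonneg) auto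
  then have "integrable lborel (\<lambda>x::'a. exp (R\<^sup>2 / (2 * \<beta>)) * exp (- (\<beta> / 2) * (norm x)\<^sup>2))"
    by simp
  then show ?thesis
  proof (rule Bochner_Integration.integrable_bound)
    show "AE x in lborel. norm (exp (w * of_real (x \<bullet> v)) * exp (- b * of_real ((norm x)\<^sup>2)))
        \<le> norm (exp (R\<^sup>2 / (2 * \<beta>)) * exp (- (\<beta> / 2) * (norm x)\<^sup>2))"
    proof (rule AE_I2)
      fix x :: 'a
      have "Re w * (x \<bullet> v) \<le> \<bar>Re w\<bar> * \<bar>x \<bullet> v\<bar>" by (metis abs_ge_self abs_mult)
      also have "\<dots> \<le> \<bar>Re w\<bar> * (norm x * norm v)"
        by (intro mult_left_mono Cauchy_Schwarz_ineq2) auto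
      also have "\<dots> = R * norm x" by (simp add: R_def)
      also have "\<dots> \<le> \<beta> / 2 * (norm x)\<^sup>2 + R\<^sup>2 / (2 * \<beta>)"
      proof -
        have "0 \<le> (\<beta> * norm x - R)\<^sup>2 / (2 * \<beta>)" using \<beta> by simp
        also have "\<dots> = \<beta> / 2 * (norm x)\<^sup>2 + R\<^sup>2 / (2 * \<beta>) - R * norm x"
          using \<beta> by (simp add: field_simps power2_eq_square)
        finally show ?thesis by simp
      qed
      finally have "Re w * (x \<bullet> v) - \<beta> * (norm x)\<^sup>2 \<le> R\<^sup>2 / (2 * \<beta>) - (\<beta> / 2) * (norm x)\<^sup>2"
        by simp
      then show "norm (exp (w * of_real (x \<bullet> v)) * exp (- b * of_real ((norm x)\<^sup>2)))
        \<le> norm (exp (R\<^sup>2 / (2 * \<beta>)) * exp (- (\<beta> / 2) * (norm x)\<^sup>2))"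
        by (simp add: norm_mult exp_add[symmetric] \<beta>_def)
    qed
  qed simp
qed

lemma gaussian_integrable:
  "Re b > 0 \<Longrightarrow> integrable lborel (\<lambda>x::'a::euclidean_space. exp (- b * of_real ((norm x)\<^sup>2)))"
  using gaussian_linear_integrable[of b 0 0] by simp

lemma gaussian_integral_of_real:
  assumes c: "c > 0"
  shows "gaussian_integral TYPE('a::euclidean_space) (of_real c) = of_real ((pi / c) powr (DIM('a) / 2))"
proof -
  have "gaussian_integral TYPE('a) (of_real c) =
      (LINT x|lborel. of_real (exp (- c * (norm (x::'a))\<^sup>2)))"
    unfolding gaussian_integral_def by (intro Bochner_Integration.integral_cong) (auto simp: exp_of_real[symmetric])
  also have "\<dots> = of_real (LINT x|lborel. exp (- c * (norm (x::'a))\<^sup>2))"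
    by simp
  also have "(LINT x|lborel. exp (- c * (norm (x::'a))\<^sup>2)) = (pi / c) powr (DIM('a) / 2)"
    by (rule integral_eq_nn_integral[THEN trans])
      (use nn_integral_gaussian[OF c, where 'a = 'a] in auto)
  finally show ?thesis .
qed

text \<open>
  Both sides are holomorphic on the right half plane and agree for real \<open>b\<close>. Squaring removes
  the half-integer power of \<open>b\<close>, and with it the choice of a branch; the modulus is all that the
  estimates below require.
\<close>

lemma gaussian_integral_squared:
  assumes b: "Re b > 0"
  shows "(gaussian_integral TYPE('a::euclidean_space) b)\<^sup>2 * b ^ DIM('a) = of_real pi ^ DIM('a)"
proof -
  let ?S = "{z. Re z > 0}"
  let ?U = "complex_of_real ` {0<..}"
  have hol: "gaussian_integral TYPE('a) holomorphic_on ?S"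
  proof -
    have "(\<lambda>z. LINT x|lborel. exp (z * of_real (- (norm (x::'a))\<^sup>2)) * 1) holomorphic_on ?S"
      using gaussian_integrable[where 'a = 'a]
      by (intro laplace_transform_holomorphic) (auto simp: open_halfspace_Re_gt)
    then show ?thesis by (simp add: gaussian_integral_def[abs_def])
  qed
  have "(gaussian_integral TYPE('a) b)\<^sup>2 * b ^ DIM('a) - of_real pi ^ DIM('a) = 0"
  proof (rule analytic_continuation[where f = "\<lambda>b. (gaussian_integral TYPE('a) b)\<^sup>2 * b ^ DIM('a) - of_real pi ^ DIM('a)"
        and S = ?S and U = ?U and \<xi> = 1])
    show "(\<lambda>b. (gaussian_integral TYPE('a) b)\<^sup>2 * b ^ DIM('a) - of_real pi ^ DIM('a)) holomorphic_on ?S"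
      by (intro holomorphic_intros hol)
    show "1 islimpt ?U"
      unfolding islimpt_approachable
    proof (intro allI impI)
      fix e :: real assume "e > 0"
      then show "\<exists>x'\<in>?U. x' \<noteq> 1 \<and> dist x' 1 < e"
        by (intro bexI[OF _ imageI[of "1 + e / 2"]]) (auto simp: dist_norm)
    qed
    fix z assume "z \<in> ?U"
    then obtain c where c: "c > 0" "z = of_real c" by auto
    have "((pi / c) powr (DIM('a) / 2))\<^sup>2 * c ^ DIM('a) = pi ^ DIM('a)"
      using c by (simp add: powr_power powr_realpow field_simps)
    then have "complex_of_real (((pi / c) powr (DIM('a) / 2))\<^sup>2 * c ^ DIM('a)) = of_real (pi ^ DIM('a))"
      by simp
    then show "(gaussian_integral TYPE('a) z)\<^sup>2 * z ^ DIM('a) - of_real pi ^ DIM('a) = 0"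
      using c by (simp add: gaussian_integral_of_real)
  qed (use b in \<open>auto simp: open_halfspace_Re_gt convex_connected convex_halfspace_Re_gt\<close>)
  then show ?thesis by simp
qed

lemma norm_gaussian_integral:
  assumes b: "Re b > 0"
  shows "norm (gaussian_integral TYPE('a::euclidean_space) b) = (pi / norm b) powr (DIM('a) / 2)"
proof -
  have b0: "norm b > 0" using b by auto
  have "(norm (gaussian_integral TYPE('a) b))\<^sup>2 * norm b ^ DIM('a) = pi ^ DIM('a)"
    using arg_cong[OF gaussian_integral_squared[OF b, where 'a = 'a], of norm]
    by (simp add: norm_mult norm_power)
  then have "(norm (gaussian_integral TYPE('a) b))\<^sup>2 = (pi / norm b) ^ DIM('a)"
    using b0 by (simp add: field_simps)
  also have "\<dots> = ((pi / norm b) powr (DIM('a) / 2))\<^sup>2"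
    using b0 by (simp add: powr_power powr_realpow)
  finally show ?thesis by simp
qed

text \<open>
  For \<open>w = - 2 b h\<close> with real \<open>h\<close> one can complete the square by the real translation
  \<open>x \<mapsto> x + h v\<close>. These \<open>w\<close> form a line through the origin, and both sides are entire
  functions of \<open>w\<close>, so the identity holds for all complex \<open>w\<close>. Purely imaginary \<open>w\<close> gives the
  Fourier transform of a complex Gaussian.
\<close>

lemma gaussian_laplace_transform:
  fixes v :: "'a::euclidean_space"
  assumes b: "Re b > 0"
  shows "(LINT x|lborel. exp (w * of_real (x \<bullet> v)) * exp (- b * of_real ((norm x)\<^sup>2)))
    = gaussian_integral TYPE('a) b * exp (w\<^sup>2 * of_real ((norm v)\<^sup>2) / (4 * b))"
proof -
  let ?K = "\<lambda>w. LINT x|lborel. exp (w * of_real (x \<bullet> v)) * exp (- b * of_real ((norm x)\<^sup>2))"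
  let ?R = "\<lambda>w. gaussian_integral TYPE('a) b * exp (w\<^sup>2 * of_real ((norm v)\<^sup>2) / (4 * b))"
  let ?U = "range (\<lambda>h. - 2 * b * of_real h)"
  have b0: "b \<noteq> 0" using b by auto
  have "?K w - ?R w = 0"
  proof (rule analytic_continuation[where f = "\<lambda>w. ?K w - ?R w" and S = UNIV and U = ?U and \<xi> = 0])
    show "(\<lambda>w. ?K w - ?R w) holomorphic_on UNIV"
      using b0 by (intro holomorphic_intros laplace_transform_holomorphic gaussian_linear_integrable b) auto
    show "0 islimpt ?U"
      unfolding islimpt_approachable
    proof (intro allI impI)
      fix e :: real assume "e > 0"
      then show "\<exists>x'\<in>?U. x' \<noteq> 0 \<and> dist x' 0 < e"
        using b0 by (intro bexI[OF _ rangeI[of _ "e / (4 * norm b)"]])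
          (auto simp: norm_mult norm_divide)
    qed
    fix z assume "z \<in> ?U"
    then obtain h where z: "z = - 2 * b * of_real h" by auto
    have "gaussian_integral TYPE('a) b = (LINT x|distr lborel borel ((+) (h *\<^sub>R v)). exp (- b * of_real ((norm x)\<^sup>2)))"
      by (simp add: lborel_distr_plus gaussian_integral_def)
    also have "\<dots> = (LINT x|lborel. exp (- b * of_real ((norm (h *\<^sub>R v + x))\<^sup>2)))"
      by (subst integral_distr) auto
    also have "\<dots> = (LINT x|lborel. exp (- (z\<^sup>2 * of_real ((norm v)\<^sup>2) / (4 * b))) *
        (exp (z * of_real (x \<bullet> v)) * exp (- b * of_real ((norm x)\<^sup>2))))"
    proof (intro Bochner_Integration.integral_cong refl)
      fix x :: 'a
      have n: "(norm (h *\<^sub>R v + x))\<^sup>2 = h\<^sup>2 * (norm v)\<^sup>2 + 2 * h * (x \<bullet> v) + (norm x)\<^sup>2"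
        unfolding power2_norm_eq_inner
        by (simp add: inner_commute inner_add_left inner_add_right algebra_simps power2_eq_square)
      have "- b * of_real ((norm (h *\<^sub>R v + x))\<^sup>2) =
        - (z\<^sup>2 * of_real ((norm v)\<^sup>2) / (4 * b)) + (z * of_real (x \<bullet> v) + - b * of_real ((norm x)\<^sup>2))"
        unfolding n z using b0 by (simp add: field_simps power2_eq_square)
      then show "exp (- b * of_real ((norm (h *\<^sub>R v + x))\<^sup>2)) =
        exp (- (z\<^sup>2 * of_real ((norm v)\<^sup>2) / (4 * b))) *
          (exp (z * of_real (x \<bullet> v)) * exp (- b * of_real ((norm x)\<^sup>2)))"
        by (simp only: exp_add)
    qed
    also have "\<dots> = exp (- (z\<^sup>2 * of_real ((norm v)\<^sup>2) / (4 * b))) * ?K z"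
      by simp
    finally have "gaussian_integral TYPE('a) b * exp (z\<^sup>2 * of_real ((norm v)\<^sup>2) / (4 * b)) = ?K z"
      by (simp add: exp_minus)
    then show "?K z - ?R z = 0" by simp
  qed auto
  then show ?thesis by simp
qed

section \<open>The Schroedinger flow of Gaussian packets\<close>

text \<open>
  The normalisation makes the Fourier transform equal to \<open>exp (- pi\<^sup>2 z \<bar>\<xi>\<bar>\<^sup>2)\<close>, with
  constant 1. The multiplier \<open>exp (- 4 pi\<^sup>2 i t \<bar>\<xi>\<bar>\<^sup>2)\<close> then just replaces \<open>z\<close> by
  \<open>z + 4 i t\<close>: the packet with parameter \<open>z\<close> has width \<open>sqrt (Re z)\<close> at the time
  \<open>- Im z / 4\<close>, when it is most concentrated.
\<close>

definition gaussian_packet :: "complex \<Rightarrow> 'a::euclidean_space \<Rightarrow> complex" where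
  "gaussian_packet z x = exp (- of_real ((norm x)\<^sup>2) / z) / gaussian_integral TYPE('a) (1 / z)"

lemma Re_inverse_pos: "Re z > 0 \<Longrightarrow> Re (1 / z) > 0"
  by (auto simp: Re_divide_of_real complex_div_cnj[of 1 z] intro!: divide_pos_pos)

lemma gaussian_integral_nonzero: "Re b > 0 \<Longrightarrow> gaussian_integral TYPE('a::euclidean_space) b \<noteq> 0"
  using norm_gaussian_integral[of b, where 'a = 'a] by auto

lemma fourier_gaussian_packet:
  fixes \<xi> :: "'a::euclidean_space"
  assumes z: "Re z > 0"
  shows "integrable lborel (\<lambda>x. gaussian_packet z x * cis (- (2 * pi * (x \<bullet> \<xi>))))" (is ?int)
    and "fourier (gaussian_packet z) \<xi> = exp (- (of_real (pi\<^sup>2) * z) * of_real ((norm \<xi>)\<^sup>2))" (is ?fourier)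
proof -
  have eq: "gaussian_packet z x * cis (- (2 * pi * (x \<bullet> \<xi>))) =
      (exp ((- 2 * of_real pi * \<i>) * of_real (x \<bullet> \<xi>)) * exp (- (1 / z) * of_real ((norm x)\<^sup>2)))
      / gaussian_integral TYPE('a) (1 / z)" for x
    by (simp add: gaussian_packet_def cis_conv_exp mult_ac)
  show ?int
    unfolding eq by (intro integrable_divide gaussian_linear_integrable Re_inverse_pos z)
  show ?fourier
    unfolding fourier_def eq integral_divide_zero gaussian_laplace_transform[OF Re_inverse_pos[OF z]]
    using gaussian_integral_nonzero[OF Re_inverse_pos[OF z], where 'a = 'a]
    by (simp add: power_mult_distrib field_simps)
qed

lemma fourier_sum_packets:
  assumes "\<And>k. k \<in> K \<Longrightarrow> Re (z k) > 0"
  shows "fourier (\<lambda>x. \<Sum>k\<in>K. gaussian_packet (z k) x) \<xi> =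
    (\<Sum>k\<in>K. exp (- (of_real (pi\<^sup>2) * z k) * of_real ((norm (\<xi>::'a::euclidean_space))\<^sup>2)))"
proof -
  have "fourier (\<lambda>x. \<Sum>k\<in>K. gaussian_packet (z k) x) \<xi> = (\<Sum>k\<in>K. fourier (gaussian_packet (z k)) \<xi>)"
    unfolding fourier_def sum_distrib_right
    by (intro Bochner_Integration.integral_sum fourier_gaussian_packet assms)
  also have "\<dots> = (\<Sum>k\<in>K. exp (- (of_real (pi\<^sup>2) * z k) * of_real ((norm \<xi>)\<^sup>2)))"
    by (intro sum.cong refl fourier_gaussian_packet assms)
  finally show ?thesis .
qed

lemma schroedinger_sum_packets:
  assumes z: "\<And>k. k \<in> K \<Longrightarrow> Re (z k) > 0"
  shows "schroedinger t (\<lambda>x. \<Sum>k\<in>K. gaussian_packet (z k) x) (x::'a::euclidean_space) =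
    (\<Sum>k\<in>K. gaussian_integral TYPE('a) (of_real (pi\<^sup>2) * (z k + 4 * \<i> * of_real t)) *
       exp (- of_real ((norm x)\<^sup>2) / (z k + 4 * \<i> * of_real t)))"
proof -
  define b where "b k = of_real (pi\<^sup>2) * (z k + 4 * \<i> * of_real t)" for k
  have b: "Re (b k) > 0" if "k \<in> K" for k
    using z[OF that] by (simp add: b_def Re_power2)
  let ?g = "\<lambda>k \<xi>. exp ((2 * of_real pi * \<i>) * of_real (\<xi> \<bullet> x)) * exp (- b k * of_real ((norm \<xi>)\<^sup>2))"
  have fourier: "fourier (\<lambda>x. \<Sum>k\<in>K. gaussian_packet (z k) x) \<xi> =
      (\<Sum>k\<in>K. exp (- (of_real (pi\<^sup>2) * z k) * of_real ((norm \<xi>)\<^sup>2)))" for \<xi> :: 'a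
    by (rule fourier_sum_packets) (rule z)
  have "schroedinger t (\<lambda>x. \<Sum>k\<in>K. gaussian_packet (z k) x) x = (LINT \<xi>|lborel. (\<Sum>k\<in>K. ?g k \<xi>))"
    unfolding schroedinger_def fourier sum_distrib_left
    by (intro Bochner_Integration.integral_cong sum.cong refl)
      (simp add: b_def cis_conv_exp exp_add[symmetric] inner_commute algebra_simps)
  also have "\<dots> = (\<Sum>k\<in>K. LINT \<xi>|lborel. ?g k \<xi>)"
    by (intro Bochner_Integration.integral_sum gaussian_linear_integrable b)
  also have "\<dots> = (\<Sum>k\<in>K. gaussian_integral TYPE('a) (b k) * exp (- of_real ((norm x)\<^sup>2) / (z k + 4 * \<i> * of_real t)))"
  proof (intro sum.cong refl)
    fix k assume k: "k \<in> K"
    have nz: "z k + 4 * \<i> * of_real t \<noteq> 0"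
      using z[OF k] by (auto simp: complex_eq_iff)
    have "(2 * of_real pi * \<i>)\<^sup>2 * of_real ((norm x)\<^sup>2) / (4 * b k) = - of_real ((norm x)\<^sup>2) / (z k + 4 * \<i> * of_real t)"
      using nz by (simp add: b_def power_mult_distrib)
    then show "(LINT \<xi>|lborel. ?g k \<xi>) =
        gaussian_integral TYPE('a) (b k) * exp (- of_real ((norm x)\<^sup>2) / (z k + 4 * \<i> * of_real t))"
      using gaussian_laplace_transform[OF b[OF k], of "2 * of_real pi * \<i>" x] by simp
  qed
  finally show ?thesis by (simp add: b_def)
qed

section \<open>Gaussian packets are Schwartz functions\<close>

text \<open>
  Polynomials times Gaussians, as the smallest class that contains the Gaussians and is closed
  under the operations that a directional derivative produces. The Gaussians are written with
  \<open>x \<bullet> x\<close>, so that the rules for the inner product differentiate them at the origin too.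
\<close>

inductive gaussian_like :: "('a::euclidean_space \<Rightarrow> complex) \<Rightarrow> bool" where
  gaussian: "Re b > 0 \<Longrightarrow> gaussian_like (\<lambda>x. exp (- b * of_real (x \<bullet> x)))"
| scale: "gaussian_like f \<Longrightarrow> gaussian_like (\<lambda>x. c * f x)"
| weight: "gaussian_like f \<Longrightarrow> gaussian_like (\<lambda>x. of_real (x \<bullet> v) * f x)"
| add: "gaussian_like f \<Longrightarrow> gaussian_like g \<Longrightarrow> gaussian_like (\<lambda>x. f x + g x)"

lemma gaussian_like_has_derivative:
  assumes "gaussian_like f"
  shows "\<exists>D. (\<forall>x. (f has_derivative D x) (at x)) \<and> (\<forall>v. gaussian_like (\<lambda>x. D x v))"
  using assms
proof induction
  case (gaussian b)
  have "((\<lambda>x. exp (- b * of_real (x \<bullet> x))) has_derivative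
      (\<lambda>v. (- 2 * b) * (of_real (x \<bullet> v) * exp (- b * of_real (x \<bullet> x))))) (at x)" for x :: 'a
  proof -
    have "((\<lambda>x. - b * complex_of_real (x \<bullet> x)) has_derivative (\<lambda>v. - b * of_real (x \<bullet> v + v \<bullet> x))) (at x)"
      by (auto intro!: derivative_eq_intros has_derivative_of_real)
    from has_derivative_compose[OF this DERIV_exp[THEN has_field_derivative_imp_has_derivative]]
    show ?thesis
      by (rule has_derivative_eq_rhs) (auto simp: inner_commute algebra_simps)
  qed
  moreover have "gaussian_like (\<lambda>x. (- 2 * b) * (of_real (x \<bullet> v) * exp (- b * of_real (x \<bullet> x))))" for v :: 'a
    by (intro gaussian_like.intros gaussian)
  ultimately show ?case by (intro exI conjI) auto
next
  case (scale f c)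
  then obtain D where "\<forall>x. (f has_derivative D x) (at x)" "\<forall>v. gaussian_like (\<lambda>x. D x v)" by blast
  then show ?case
    by (intro exI[of _ "\<lambda>x v. c * D x v"]) (auto intro: gaussian_like.intros has_derivative_mult_right)
next
  case (weight f w)
  then obtain D where D: "\<forall>x. (f has_derivative D x) (at x)" "\<forall>v. gaussian_like (\<lambda>x. D x v)" by blast
  have "((\<lambda>x. of_real (x \<bullet> w) * f x) has_derivative (\<lambda>v. of_real (x \<bullet> w) * D x v + of_real (v \<bullet> w) * f x)) (at x)" for x
    using D(1) by (auto intro!: derivative_eq_intros has_derivative_of_real)
  then show ?case
    using D(2) weight.hyps
    by (intro exI[of _ "\<lambda>x v. of_real (x \<bullet> w) * D x v + of_real (v \<bullet> w) * f x"] conjI allI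
        gaussian_like.intros) auto
next
  case (add f g)
  then obtain D E where "\<forall>x. (f has_derivative D x) (at x)" "\<forall>v. gaussian_like (\<lambda>x. D x v)"
    "\<forall>x. (g has_derivative E x) (at x)" "\<forall>v. gaussian_like (\<lambda>x. E x v)" by blast
  then show ?case
    by (intro exI[of _ "\<lambda>x v. D x v + E x v"]) (auto intro: gaussian_like.intros has_derivative_add)
qed

lemma gaussian_like_rapid_decay:
  assumes "gaussian_like f"
  shows "\<exists>B. \<forall>x. norm x ^ k * norm (f x) \<le> B"
  using assms
proof (induction arbitrary: k)
  case (gaussian b)
  define a n where "a = Re b" and "n = Suc k"
  have a: "a > 0" "n > 0" using gaussian by (auto simp: a_def n_def)
  have "norm x ^ k * norm (exp (- b * of_real (x \<bullet> x))) \<le> 1 + (n / a) ^ n" for x :: 'a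
  proof -
    let ?r = "norm x"
    have "0 \<le> a * ?r\<^sup>2" using a by simp
    then have r: "- real n \<le> a * ?r\<^sup>2" by linarith
    have "(a * ?r\<^sup>2 / n) ^ n \<le> (1 + a * ?r\<^sup>2 / n) ^ n"
      using a by (intro power_mono) auto
    also have "\<dots> \<le> exp (a * ?r\<^sup>2)"
      using a r by (intro exp_ge_one_plus_x_over_n_power_n) auto
    finally have "?r ^ (2 * n) \<le> (n / a) ^ n * exp (a * ?r\<^sup>2)"
      using a by (simp add: power_divide power_mult_distrib power_mult[symmetric] field_simps)
    moreover have "?r ^ k \<le> 1 + ?r ^ (2 * n)"
    proof (cases "?r \<le> 1")
      case True
      then show ?thesis by (simp add: power_le_one add_increasing2)
    next
      case False
      then have "?r ^ k \<le> ?r ^ (2 * n)" by (intro power_increasing) (auto simp: n_def)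
      then show ?thesis by simp
    qed
    moreover have "1 \<le> exp (a * ?r\<^sup>2)" using a by simp
    ultimately have "?r ^ k \<le> (1 + (n / a) ^ n) * exp (a * ?r\<^sup>2)"
      unfolding distrib_right mult_1_left by linarith
    then have "?r ^ k * exp (- (a * ?r\<^sup>2)) \<le> 1 + (n / a) ^ n"
      by (simp add: exp_minus field_simps)
    then show ?thesis by (simp add: a_def power2_norm_eq_inner)
  qed
  then show ?case by blast
next
  case (scale f c)
  obtain B where "\<forall>x. norm x ^ k * norm (f x) \<le> B" using scale.IH by blast
  then have "norm x ^ k * norm (c * f x) \<le> norm c * B" for x
    using mult_left_mono[of "norm x ^ k * norm (f x)" B "norm c"] by (simp add: norm_mult mult_ac)
  then show ?case by blast
next
  case (weight f v)
  obtain B where B: "\<forall>x. norm x ^ Suc k * norm (f x) \<le> B" using weight.IH by blast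
  have "norm x ^ k * norm (of_real (x \<bullet> v) * f x) \<le> norm v * B" for x
  proof -
    have "norm x ^ k * norm (of_real (x \<bullet> v) * f x) = norm x ^ k * norm (f x) * \<bar>x \<bullet> v\<bar>"
      by (simp add: norm_mult)
    also have "\<dots> \<le> norm x ^ k * norm (f x) * (norm x * norm v)"
      by (intro mult_left_mono Cauchy_Schwarz_ineq2) auto
    also have "\<dots> = norm v * (norm x ^ Suc k * norm (f x))" by simp
    also have "\<dots> \<le> norm v * B" using B by (intro mult_left_mono) auto
    finally show ?thesis .
  qed
  then show ?case by blast
next
  case (add f g)
  obtain A B where "\<forall>x. norm x ^ k * norm (f x) \<le> A" "\<forall>x. norm x ^ k * norm (g x) \<le> B"
    using add.IH by blast
  then have "norm x ^ k * norm (f x + g x) \<le> A + B" for x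
    using mult_left_mono[OF norm_triangle_ineq[of "f x" "g x"], of "norm x ^ k"]
    by (smt (verit) distrib_left norm_ge_zero zero_le_power)
  then show ?case by blast
qed

lemma gaussian_like_schwartz:
  assumes "gaussian_like f"
  shows "schwartz f"
proof -
  have frechet: "gaussian_like (\<lambda>x. frechet_derivative f (at x) v)" if f: "gaussian_like f" for f :: "'a \<Rightarrow> complex" and v
  proof -
    obtain D where D: "\<forall>x. (f has_derivative D x) (at x)" "\<forall>v. gaussian_like (\<lambda>x. D x v)"
      using gaussian_like_has_derivative[OF f] by blast
    then have "frechet_derivative f (at x) = D x" for x
      using frechet_derivative_at by metis
    then show ?thesis using D by simp
  qed
  have iter: "gaussian_like (iter_deriv vs f)" for vs
    by (induction vs) (use assms frechet in auto)
  have "iter_deriv vs f differentiable_on UNIV" for vs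
    using gaussian_like_has_derivative[OF iter[of vs]]
    by (auto simp: differentiable_on_def differentiable_def)
  then show ?thesis
    unfolding schwartz_def smooth_def using gaussian_like_rapid_decay[OF iter] by blast
qed

lemma sum_packets_schwartz:
  assumes "finite K" "K \<noteq> {}" "\<And>k. k \<in> K \<Longrightarrow> Re (z k) > 0"
  shows "schwartz (\<lambda>x::'a::euclidean_space. \<Sum>k\<in>K. gaussian_packet (z k) x)"
proof (rule gaussian_like_schwartz)
  have one: "gaussian_like (\<lambda>x::'a. gaussian_packet w x)" if w: "Re w > 0" for w
    using scale[OF gaussian[OF Re_inverse_pos[OF w]], of "1 / gaussian_integral TYPE('a) (1 / w)"]
    by (simp add: gaussian_packet_def power2_norm_eq_inner)
  show "gaussian_like (\<lambda>x::'a. \<Sum>k\<in>K. gaussian_packet (z k) x)"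
    using assms
  proof (induction rule: finite_ne_induct)
    case (singleton k)
    then show ?case using one by simp
  next
    case (insert k F)
    then have "gaussian_like (\<lambda>x::'a. gaussian_packet (z k) x + (\<Sum>k\<in>F. gaussian_packet (z k) x))"
      by (intro gaussian_like.add one) auto
    then show ?case using insert.hyps by simp
  qed
qed

section \<open>Lower bounds for amalgam norms\<close>

lemma ennreal_powr_mono: "x \<le> y \<Longrightarrow> 0 \<le> a \<Longrightarrow> ennreal_powr x a \<le> ennreal_powr y a"
  by (auto simp: ennreal_powr_def top.extremum_unique less_top
      intro!: ennreal_leI powr_mono2 enn2real_mono)

lemma ennreal_powr_ennreal: "0 \<le> x \<Longrightarrow> ennreal_powr (ennreal x) a = ennreal (x powr a)"
  by (simp add: ennreal_powr_def)

text \<open>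
  Chebyshev's inequality with the factors rearranged. The exponent \<open>1 / enn2real p\<close> stands for
  \<open>1 / p\<close> throughout: for \<open>p = \<infinity>\<close> it is \<open>1 / 0 = 0\<close>, as the convention \<open>1 / \<infinity> = 0\<close> demands.
  The function \<open>F\<close> is arbitrary, so that the lemma can be applied to a norm that depends on a
  parameter, layer after layer, from pointwise bounds alone.
\<close>

lemma Lp_norm_ge:
  fixes F :: "'a::euclidean_space \<Rightarrow> ennreal"
  assumes p: "1 \<le> p" and A: "A \<in> sets lborel" "emeasure lborel A = ennreal m" "m > 0"
    and c: "c \<ge> 0" and F: "\<And>x. x \<in> A \<Longrightarrow> ennreal c \<le> F x"
  shows "ennreal (c * m powr (1 / enn2real p)) \<le> Lp_norm p F"
proof (cases "p = \<infinity>")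
  case True
  have "ennreal c \<le> esssup lborel F"
  proof (rule ccontr)
    assume less: "\<not> ennreal c \<le> esssup lborel F"
    have "AE x in lborel. x \<notin> A"
      using esssup_AE[of F lborel]
    proof (rule AE_mp, intro AE_I2 impI notI)
      fix x assume "F x \<le> esssup lborel F" "x \<in> A"
      then show False using F[of x] less by (meson order_trans)
    qed
    then have "emeasure lborel A = 0"
      using A(1) by (subst (asm) AE_iff_measurable[of A]) auto
    then show False using A by simp
  qed
  then show ?thesis using True A by (simp add: Lp_norm_def)
next
  case False
  define P where "P = enn2real p"
  have P: "P > 0" using p False
    by (auto simp: P_def enn2real_positive_iff less_top intro: less_le_trans[of 0 1])
  have "ennreal (c powr P * m) = (\<integral>\<^sup>+x. ennreal (c powr P) * indicator A x \<partial>lborel)"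
    using A by (simp add: nn_integral_cmult_indicator ennreal_mult)
  also have "\<dots> \<le> (\<integral>\<^sup>+x. ennreal_powr (F x) P \<partial>lborel)"
  proof (intro nn_integral_mono)
    fix x :: 'a
    show "ennreal (c powr P) * indicator A x \<le> ennreal_powr (F x) P"
    proof (cases "x \<in> A")
      case True
      then show ?thesis
        using ennreal_powr_mono[OF F[of x], of P] P c by (simp add: ennreal_powr_ennreal)
    qed simp
  qed
  finally have "ennreal_powr (ennreal (c powr P * m)) (1 / P) \<le> Lp_norm p F"
    using False P by (auto simp: Lp_norm_def P_def[symmetric] intro!: ennreal_powr_mono)
  moreover have "(c powr P * m) powr (1 / P) = c * m powr (1 / P)"
    using c P A by (simp add: powr_mult powr_powr)
  ultimately show ?thesis using c A by (simp add: ennreal_powr_ennreal P_def)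
qed

definition ball_vol :: "'a::euclidean_space itself \<Rightarrow> real \<Rightarrow> real" where
  "ball_vol _ s = unit_ball_vol (real DIM('a)) * s ^ DIM('a)"

lemma ball_vol_pos: "s > 0 \<Longrightarrow> ball_vol TYPE('a::euclidean_space) s > 0"
  by (simp add: ball_vol_def)

lemma emeasure_ball_vol: "s > 0 \<Longrightarrow> emeasure lborel (ball (c::'a::euclidean_space) s) = ennreal (ball_vol TYPE('a) s)"
  by (simp add: ball_vol_def emeasure_ball)

text \<open>
  For \<open>y\<close> in \<open>Y\<close> the translated window is at least \<open>\<epsilon>\<close> on a ball of radius \<open>s\<close> on which
  \<open>F\<close> is at least \<open>c\<close>. The volume of that ball enters with the local exponent, the measure of
  \<open>Y\<close> with the global one.
\<close>

lemma amalgam_norm_ge: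
  fixes F :: "'a::euclidean_space \<Rightarrow> ennreal"
  assumes pq: "1 \<le> p" "1 \<le> q" and "0 \<le> \<epsilon>" "0 \<le> c" "0 < s"
    and g: "\<And>x. x \<in> ball x0 \<rho> \<Longrightarrow> \<epsilon> \<le> norm (g x)"
    and Y: "Y \<in> sets lborel" "emeasure lborel Y = ennreal M" "M > 0"
    and sub: "\<And>y. y \<in> Y \<Longrightarrow> ball (z y) s \<subseteq> ball (y + x0) \<rho>"
    and F: "\<And>y x. y \<in> Y \<Longrightarrow> x \<in> ball (z y) s \<Longrightarrow> ennreal c \<le> F x"
  shows "ennreal (c * \<epsilon> * ball_vol TYPE('a) s powr (1 / enn2real p) * M powr (1 / enn2real q))
    \<le> amalgam_norm p q g F"
  unfolding amalgam_norm_def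
proof (rule Lp_norm_ge[OF pq(2) Y])
  fix y assume y: "y \<in> Y"
  show "ennreal (c * \<epsilon> * ball_vol TYPE('a) s powr (1 / enn2real p))
    \<le> Lp_norm p (\<lambda>x. F x * ennreal (norm (g (x - y))))"
  proof (rule Lp_norm_ge[OF pq(1)])
    fix x assume x: "x \<in> ball (z y) s"
    then have "x \<in> ball (y + x0) \<rho>" using sub y by blast
    then have "x - y \<in> ball x0 \<rho>" by (simp add: dist_norm algebra_simps)
    then have "ennreal c * ennreal \<epsilon> \<le> F x * ennreal (norm (g (x - y)))"
      by (intro mult_mono F[OF y x] ennreal_leI g) auto
    then show "ennreal (c * \<epsilon>) \<le> F x * ennreal (norm (g (x - y)))"
      using assms by (simp add: ennreal_mult)
  qed (use assms ball_vol_pos emeasure_ball_vol in auto)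
qed (use assms in auto)

text \<open>
  A window is continuous and, having norm 1, not identically zero. A radius of at most 1/2 lets
  balls with centres at distance 1 be disjoint later on.
\<close>

lemma window_bounded_below:
  fixes g :: "'a::euclidean_space \<Rightarrow> complex"
  assumes "window g"
  obtains x0 \<rho> \<epsilon> where "0 < \<rho>" "\<rho> \<le> 1 / 2" "0 < \<epsilon>" "\<And>x. x \<in> ball x0 \<rho> \<Longrightarrow> \<epsilon> \<le> norm (g x)"
proof -
  have "\<exists>x. g x \<noteq> 0"
  proof (rule ccontr)
    assume "\<not> ?thesis"
    then have "Lp_norm 2 (\<lambda>x. ennreal (norm (g x))) = 0"
      by (simp add: Lp_norm_def ennreal_powr_def)
    then show False using assms by (simp add: window_def)
  qed
  then obtain x0 where x0: "g x0 \<noteq> 0" by blast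
  have "\<forall>vs. set vs \<subseteq> Basis \<longrightarrow> iter_deriv vs g differentiable_on UNIV"
    using assms by (simp add: window_def test_function_def smooth_def)
  then have "g differentiable_on UNIV" by (metis empty_subsetI iter_deriv.simps(1) list.set(1))
  then have "continuous (at x0) g"
    by (metis UNIV_I continuous_on_eq_continuous_at differentiable_imp_continuous_on open_UNIV)
  moreover have "norm (g x0) / 2 > 0" using x0 by simp
  ultimately obtain e where e: "e > 0" "\<And>x. dist x x0 < e \<Longrightarrow> dist (g x) (g x0) < norm (g x0) / 2"
    unfolding continuous_at_eps_delta by blast
  show ?thesis
  proof (rule that[of "min e (1 / 2)" "norm (g x0) / 2" x0])
    fix x assume "x \<in> ball x0 (min e (1 / 2))"
    then have "norm (g x - g x0) < norm (g x0) / 2" using e(2)[of x] by (simp add: dist_norm norm_minus_commute)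
    then show "norm (g x0) / 2 \<le> norm (g x)"
      using norm_triangle_ineq2[of "g x0" "g x"] by (simp add: norm_minus_commute)
  qed (use e x0 in auto)
qed

text \<open>
  A ball that is smaller than the window is seen whole by a fixed set of translates; its size
  is measured by the local exponent \<open>p\<close>.
\<close>

lemma amalgam_norm_ge_small_ball:
  fixes g :: "'a::euclidean_space \<Rightarrow> complex"
  assumes g: "window g" and pq: "1 \<le> p" "1 \<le> q"
  obtains \<rho> K where "0 < \<rho>" "0 < K"
    "\<And>r c F. 0 < r \<Longrightarrow> r \<le> \<rho> \<Longrightarrow> 0 \<le> c \<Longrightarrow> (\<And>x. x \<in> ball 0 r \<Longrightarrow> ennreal c \<le> F x) \<Longrightarrow>
       ennreal (K * c * r powr (DIM('a) / enn2real p)) \<le> amalgam_norm p q g F"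
proof -
  obtain x0 \<rho> \<epsilon> where h: "0 < \<rho>" "0 < \<epsilon>" "\<And>x. x \<in> ball x0 \<rho> \<Longrightarrow> \<epsilon> \<le> norm (g x)"
    using window_bounded_below[OF g] by metis
  define K where "K = \<epsilon> * unit_ball_vol (real DIM('a)) powr (1 / enn2real p) *
      ball_vol TYPE('a) (\<rho> / 2) powr (1 / enn2real q)"
  show ?thesis
  proof (rule that[of "\<rho> / 2" K])
    have "unit_ball_vol (real DIM('a)) \<noteq> 0" using unit_ball_vol_pos[of "real DIM('a)"] by linarith
    then show "K > 0" using h ball_vol_pos[of "\<rho> / 2", where 'a = 'a] by (simp add: K_def)
    fix r c :: real and F :: "'a \<Rightarrow> ennreal"
    assume r: "0 < r" "r \<le> \<rho> / 2" and c: "0 \<le> c" and F: "\<And>x. x \<in> ball 0 r \<Longrightarrow> ennreal c \<le> F x"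
    have "ennreal (c * \<epsilon> * ball_vol TYPE('a) r powr (1 / enn2real p) *
        ball_vol TYPE('a) (\<rho> / 2) powr (1 / enn2real q)) \<le> amalgam_norm p q g F"
    proof (rule amalgam_norm_ge[where Y = "ball (- x0) (\<rho> / 2)" and z = "\<lambda>_. 0"])
      fix y assume y: "y \<in> ball (- x0) (\<rho> / 2)"
      then have y': "norm (y + x0) < \<rho> / 2" by (simp add: dist_norm norm_minus_commute add.commute)
      show "ball 0 r \<subseteq> ball (y + x0) \<rho>"
      proof
        fix x assume "x \<in> ball (0::'a) r"
        then have "norm x < r" by simp
        then show "x \<in> ball (y + x0) \<rho>"
          using y' r norm_triangle_ineq4[of "y + x0" x] by (simp add: dist_norm)
      qed
    qed (use pq h r c F in \<open>auto simp: ball_vol_pos emeasure_ball_vol\<close>)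
    moreover have "c * \<epsilon> * ball_vol TYPE('a) r powr (1 / enn2real p) *
        ball_vol TYPE('a) (\<rho> / 2) powr (1 / enn2real q) = K * c * r powr (DIM('a) / enn2real p)"
      using r by (simp add: K_def ball_vol_def powr_mult powr_realpow[symmetric] powr_powr mult_ac)
    ultimately show "ennreal (K * c * r powr (DIM('a) / enn2real p)) \<le> amalgam_norm p q g F"
      by simp
  qed (use h in auto)
qed

text \<open>
  A ball that is larger than the window is tiled by translates, each of which sees a fixed
  volume; the number of translates is measured by the global exponent \<open>q\<close>.
\<close>

lemma amalgam_norm_ge_large_ball:
  fixes g :: "'a::euclidean_space \<Rightarrow> complex"
  assumes g: "window g" and pq: "1 \<le> p" "1 \<le> q"
  obtains K where "0 < K"
    "\<And>r c F. 1 \<le> r \<Longrightarrow> 0 \<le> c \<Longrightarrow> (\<And>x. x \<in> ball 0 r \<Longrightarrow> ennreal c \<le> F x) \<Longrightarrow>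
       ennreal (K * c * r powr (DIM('a) / enn2real q)) \<le> amalgam_norm p q g F"
proof -
  obtain x0 \<rho> \<epsilon> where h: "0 < \<rho>" "\<rho> \<le> 1 / 2" "0 < \<epsilon>" "\<And>x. x \<in> ball x0 \<rho> \<Longrightarrow> \<epsilon> \<le> norm (g x)"
    using window_bounded_below[OF g] by metis
  define K where "K = \<epsilon> * ball_vol TYPE('a) \<rho> powr (1 / enn2real p) *
      ball_vol TYPE('a) (1 / 2) powr (1 / enn2real q)"
  show ?thesis
  proof (rule that[of K])
    show "K > 0" using h ball_vol_pos[of \<rho>, where 'a = 'a] ball_vol_pos[of "1 / 2", where 'a = 'a]
      by (simp add: K_def)
    fix r c :: real and F :: "'a \<Rightarrow> ennreal"
    assume r: "1 \<le> r" and c: "0 \<le> c" and F: "\<And>x. x \<in> ball 0 r \<Longrightarrow> ennreal c \<le> F x"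
    have "ennreal (c * \<epsilon> * ball_vol TYPE('a) \<rho> powr (1 / enn2real p) *
        ball_vol TYPE('a) (r / 2) powr (1 / enn2real q)) \<le> amalgam_norm p q g F"
    proof (rule amalgam_norm_ge[where Y = "ball (- x0) (r / 2)" and z = "\<lambda>y. y + x0"])
      fix y x assume y: "y \<in> ball (- x0) (r / 2)" and x: "x \<in> ball (y + x0) \<rho>"
      have "norm x \<le> norm (x - (y + x0)) + norm (y + x0)" by norm
      also have "\<dots> < \<rho> + r / 2"
        using x y by (intro add_strict_mono) (auto simp: dist_norm norm_minus_commute add.commute)
      finally show "ennreal c \<le> F x" using h r by (intro F) simp
    qed (use pq h r c in \<open>auto simp: ball_vol_pos emeasure_ball_vol\<close>)
    moreover have "c * \<epsilon> * ball_vol TYPE('a) \<rho> powr (1 / enn2real p) *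
        ball_vol TYPE('a) (r / 2) powr (1 / enn2real q) = K * c * r powr (DIM('a) / enn2real q)"
    proof -
      have "ball_vol TYPE('a) (r / 2) = ball_vol TYPE('a) (1 / 2) * r powr DIM('a)"
        using r by (simp add: ball_vol_def powr_realpow power_divide)
      then show ?thesis
        using r ball_vol_pos[of "1 / 2", where 'a = 'a] by (simp add: K_def powr_mult powr_powr mult_ac)
    qed
    ultimately show "ennreal (K * c * r powr (DIM('a) / enn2real q)) \<le> amalgam_norm p q g F"
      by simp
  qed
qed

text \<open>
  Separated unit balls are seen by disjoint sets of translates, so that their number also enters
  with the global exponent, however far apart they are.
\<close>

lemma amalgam_norm_ge_separated_balls:
  fixes g :: "'a::euclidean_space \<Rightarrow> complex"
  assumes g: "window g" and pq: "1 \<le> p" "1 \<le> q"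
  obtains K where "0 < K"
    "\<And>I a c F. finite I \<Longrightarrow> I \<noteq> {} \<Longrightarrow> (\<And>i j. i \<in> I \<Longrightarrow> j \<in> I \<Longrightarrow> i \<noteq> j \<Longrightarrow> 1 \<le> dist (a i) (a j)) \<Longrightarrow> 0 \<le> c \<Longrightarrow>
       (\<And>i x. i \<in> I \<Longrightarrow> x \<in> ball (a i) 1 \<Longrightarrow> ennreal c \<le> F x) \<Longrightarrow>
       ennreal (K * c * card (I::nat set) powr (1 / enn2real q)) \<le> amalgam_norm p q g F"
proof -
  obtain x0 \<rho> \<epsilon> where h: "0 < \<rho>" "\<rho> \<le> 1 / 2" "0 < \<epsilon>" "\<And>x. x \<in> ball x0 \<rho> \<Longrightarrow> \<epsilon> \<le> norm (g x)"
    using window_bounded_below[OF g] by metis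
  define v where "v = ball_vol TYPE('a) \<rho>"
  have v: "v > 0" using h ball_vol_pos by (simp add: v_def)
  show ?thesis
  proof (rule that[of "\<epsilon> * v powr (1 / enn2real p) * v powr (1 / enn2real q)"])
    fix I :: "nat set" and a c and F :: "'a \<Rightarrow> ennreal"
    assume I: "finite I" "I \<noteq> {}" and sep: "\<And>i j. i \<in> I \<Longrightarrow> j \<in> I \<Longrightarrow> i \<noteq> j \<Longrightarrow> 1 \<le> dist (a i) (a j)"
      and c: "0 \<le> c" and F: "\<And>i x. i \<in> I \<Longrightarrow> x \<in> ball (a i) 1 \<Longrightarrow> ennreal c \<le> F x"
    define B where "B i = ball (a i - x0) \<rho>" for i
    have disj: "disjoint_family_on B I"
      unfolding disjoint_family_on_def
    proof (intro ballI impI)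
      fix i j assume ij: "i \<in> I" "j \<in> I" "i \<noteq> j"
      then have "1 \<le> dist (a i - x0) (a j - x0)" using sep by (simp add: dist_norm)
      then show "B i \<inter> B j = {}"
        unfolding B_def using h by (intro disjoint_ballI) auto
    qed
    have Bs: "B i \<in> sets lborel" for i by (simp add: B_def)
    have "emeasure lborel (\<Union>i\<in>I. B i) = (\<Sum>i\<in>I. emeasure lborel (B i))"
      by (intro sum_emeasure[symmetric]) (use I Bs disj in auto)
    also have "\<dots> = ennreal (card I * v)"
      using h v by (simp add: B_def emeasure_ball_vol v_def[symmetric] ennreal_mult ennreal_of_nat_eq_real_of_nat)
    finally have UB: "emeasure lborel (\<Union>i\<in>I. B i) = ennreal (card I * v)" .
    have "ennreal (c * \<epsilon> * ball_vol TYPE('a) \<rho> powr (1 / enn2real p) * (card I * v) powr (1 / enn2real q))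
      \<le> amalgam_norm p q g F"
    proof (rule amalgam_norm_ge[where Y = "\<Union>i\<in>I. B i" and z = "\<lambda>y. y + x0" and \<rho> = \<rho>])
      fix y x assume "y \<in> (\<Union>i\<in>I. B i)" and x: "x \<in> ball (y + x0) \<rho>"
      then obtain i where i: "i \<in> I" "y \<in> B i" by blast
      have "norm (x - a i) \<le> norm (x - (y + x0)) + norm (y - (a i - x0))" by norm
      also have "\<dots> < \<rho> + \<rho>"
        using i x by (intro add_strict_mono) (auto simp: B_def dist_norm norm_minus_commute)
      finally show "ennreal c \<le> F x" using h i(1) by (intro F[of i]) (auto simp: dist_norm norm_minus_commute)
    qed (use pq h c v I UB in \<open>auto simp: B_def card_gt_0_iff\<close>)
    then show "ennreal (\<epsilon> * v powr (1 / enn2real p) * v powr (1 / enn2real q) * c * card I powr (1 / enn2real q))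
      \<le> amalgam_norm p q g F"
      using v by (simp add: v_def[symmetric] powr_mult mult_ac)
  qed (use h v in auto)
qed

section \<open>Size of the packets and of their evolution\<close>

text \<open>
  The product of two packets (one conjugated) is again a Gaussian, and its integral has modulus
  \<open>(pi \<bar>z j + cnj (z k)\<bar>) powr (- d / 2)\<close> by the formula for the modulus of a Gaussian integral.
  It is small when the focusing times \<open>- Im (z j) / 4\<close> and \<open>- Im (z k) / 4\<close> are far apart, which
  makes packets with distant focusing times nearly orthogonal.
\<close>

lemma sum_packets_L2:
  assumes K: "finite K" and z: "\<And>k. k \<in> K \<Longrightarrow> Re (z k) > 0"
  shows "Lp_norm 2 (\<lambda>x::'a::euclidean_space. ennreal (norm (\<Sum>k\<in>K. gaussian_packet (z k) x)))
    \<le> ennreal (sqrt (\<Sum>j\<in>K. \<Sum>k\<in>K. (1 / (pi * norm (z j + cnj (z k)))) powr (DIM('a) / 2)))"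
proof -
  let ?u = "\<lambda>x::'a. \<Sum>k\<in>K. gaussian_packet (z k) x"
  let ?S = "\<Sum>j\<in>K. \<Sum>k\<in>K. (1 / (pi * norm (z j + cnj (z k)))) powr (DIM('a) / 2)"
  let ?G = "gaussian_integral TYPE('a)"
  have zz: "Re (1 / z j + 1 / cnj (z k)) > 0" if "j \<in> K" "k \<in> K" for j k
    using Re_inverse_pos[OF z[OF that(1)]] Re_inverse_pos[of "cnj (z k)"] z[OF that(2)] by simp
  have eq: "gaussian_packet (z j) x * cnj (gaussian_packet (z k) x) =
      exp (- (1 / z j + 1 / cnj (z k)) * of_real ((norm x)\<^sup>2)) / (?G (1 / z j) * cnj (?G (1 / z k)))" for j k and x :: 'a
    by (simp add: gaussian_packet_def exp_cnj exp_add[symmetric] field_simps)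
  have int: "integrable lborel (\<lambda>x::'a. gaussian_packet (z j) x * cnj (gaussian_packet (z k) x))"
    if "j \<in> K" "k \<in> K" for j k
    unfolding eq by (intro integrable_divide gaussian_integrable zz that)
  have val: "norm (LINT x|lborel. gaussian_packet (z j) (x::'a) * cnj (gaussian_packet (z k) x)) =
      (1 / (pi * norm (z j + cnj (z k)))) powr (DIM('a) / 2)" if jk: "j \<in> K" "k \<in> K" for j k
  proof -
    have nz: "norm (z j) > 0" "norm (z k) > 0" "norm (z j + cnj (z k)) > 0"
      using z[OF jk(1)] z[OF jk(2)] by (auto simp: complex_eq_iff)
    have n: "norm (1 / z j + 1 / cnj (z k)) = norm (z j + cnj (z k)) / (norm (z j) * norm (z k))"
    proof -
      have "1 / z j + 1 / cnj (z k) = (z j + cnj (z k)) / (z j * cnj (z k))"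
        using nz by (simp add: field_simps)
      then show ?thesis by (simp add: norm_divide norm_mult)
    qed
    have "norm (LINT x|lborel. gaussian_packet (z j) (x::'a) * cnj (gaussian_packet (z k) x)) =
        norm (?G (1 / z j + 1 / cnj (z k))) / (norm (?G (1 / z j)) * norm (?G (1 / z k)))"
      unfolding eq by (simp add: gaussian_integral_def norm_divide norm_mult)
    also have "\<dots> = (pi / (norm (z j + cnj (z k)) / (norm (z j) * norm (z k)))) powr (DIM('a) / 2) /
       ((pi * norm (z j)) powr (DIM('a) / 2) * (pi * norm (z k)) powr (DIM('a) / 2))"
      unfolding norm_gaussian_integral[OF zz[OF jk]] norm_gaussian_integral[OF Re_inverse_pos[OF z[OF jk(1)]]]
        norm_gaussian_integral[OF Re_inverse_pos[OF z[OF jk(2)]]] n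
      by (simp add: norm_divide)
    also have "\<dots> = ((pi / (norm (z j + cnj (z k)) / (norm (z j) * norm (z k)))) / ((pi * norm (z j)) * (pi * norm (z k)))) powr (DIM('a) / 2)"
      by (simp add: powr_divide powr_mult)
    also have "(pi / (norm (z j + cnj (z k)) / (norm (z j) * norm (z k)))) / ((pi * norm (z j)) * (pi * norm (z k))) = 1 / (pi * norm (z j + cnj (z k)))"
      using nz by (simp add: field_simps)
    finally show ?thesis .
  qed
  have sq: "of_real ((norm (?u x))\<^sup>2) = (\<Sum>j\<in>K. \<Sum>k\<in>K. gaussian_packet (z j) x * cnj (gaussian_packet (z k) x))" for x
    unfolding complex_norm_square by (simp add: sum_product)
  have intc: "integrable lborel (\<lambda>x. complex_of_real ((norm (?u x))\<^sup>2))"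
    unfolding sq by (intro Bochner_Integration.integrable_sum int)
  then have intr: "integrable lborel (\<lambda>x. (norm (?u x))\<^sup>2)"
    using complex_of_real_integrable_eq by blast
  have "(LINT x|lborel. (norm (?u x))\<^sup>2) \<le> norm (complex_of_real (LINT x|lborel. (norm (?u x))\<^sup>2))"
    by simp
  also have "complex_of_real (LINT x|lborel. (norm (?u x))\<^sup>2) = (LINT x|lborel. complex_of_real ((norm (?u x))\<^sup>2))"
    by (rule integral_complex_of_real[symmetric])
  also have "\<dots> = (\<Sum>j\<in>K. \<Sum>k\<in>K. LINT x|lborel. gaussian_packet (z j) (x::'a) * cnj (gaussian_packet (z k) x))"
    unfolding sq by (simp add: int Bochner_Integration.integral_sum Bochner_Integration.integrable_sum)
  also have "norm \<dots> \<le> (\<Sum>j\<in>K. \<Sum>k\<in>K. norm (LINT x|lborel. gaussian_packet (z j) (x::'a) * cnj (gaussian_packet (z k) x)))"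
    by (rule order_trans[OF norm_sum]) (intro sum_mono norm_sum)
  also have "\<dots> = ?S" by (simp add: val)
  finally have le: "(LINT x|lborel. (norm (?u x))\<^sup>2) \<le> ?S" .
  have "Lp_norm 2 (\<lambda>x. ennreal (norm (?u x))) = ennreal_powr (\<integral>\<^sup>+x. ennreal ((norm (?u x))\<^sup>2) \<partial>lborel) (1 / 2)"
    by (simp add: Lp_norm_def ennreal_powr_ennreal powr_numeral)
  also have "(\<integral>\<^sup>+x. ennreal ((norm (?u x))\<^sup>2) \<partial>lborel) = ennreal (LINT x|lborel. (norm (?u x))\<^sup>2)"
    using intr by (rule nn_integral_eq_integral) auto
  also have "ennreal_powr \<dots> (1 / 2) \<le> ennreal_powr (ennreal ?S) (1 / 2)"
    using le by (intro ennreal_powr_mono ennreal_leI) auto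
  also have "\<dots> = ennreal (sqrt ?S)"
    by (simp add: ennreal_powr_ennreal sum_nonneg powr_half_sqrt)
  finally show ?thesis .
qed

text \<open>
  The dispersive estimate for a packet: with \<open>\<zeta> = z + 4 i t\<close> its size decays like
  \<open>\<bar>\<zeta>\<bar> powr (- d / 2)\<close>, uniformly in \<open>x\<close>, and this size is attained up to a constant where
  \<open>\<bar>x\<bar>\<^sup>2\<close> is at most of order \<open>\<bar>\<zeta>\<bar>\<close>.
\<close>

lemma norm_evolved_packet:
  fixes x :: "'a::euclidean_space"
  assumes \<zeta>: "Re \<zeta> > 0"
  defines "A \<equiv> gaussian_integral TYPE('a) (of_real (pi\<^sup>2) * \<zeta>) * exp (- of_real ((norm x)\<^sup>2) / \<zeta>)"
  shows "norm A \<le> (1 / (pi * norm \<zeta>)) powr (DIM('a) / 2)"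
    and "(1 / (pi * norm \<zeta>)) powr (DIM('a) / 2) * exp (- ((norm x)\<^sup>2 / norm \<zeta>)) \<le> norm A"
proof -
  have nz: "norm \<zeta> > 0" using \<zeta> by auto
  have b: "Re (of_real (pi\<^sup>2) * \<zeta>) > 0" using \<zeta> by simp
  have "norm (exp (- of_real ((norm x)\<^sup>2) / \<zeta>)) = exp (- ((norm x)\<^sup>2 * Re (1 / \<zeta>)))"
  proof -
    have "- of_real ((norm x)\<^sup>2) / \<zeta> = of_real (- (norm x)\<^sup>2) * (1 / \<zeta>)" by simp
    moreover have "Re (of_real a * w) = a * Re w" for a w by simp
    ultimately have "Re (- of_real ((norm x)\<^sup>2) / \<zeta>) = - (norm x)\<^sup>2 * Re (1 / \<zeta>)"
      by (simp only:)
    then show ?thesis by (simp only: norm_exp_eq_Re) simp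
  qed
  moreover have "pi / norm (of_real (pi\<^sup>2) * \<zeta>) = 1 / (pi * norm \<zeta>)"
    by (simp add: norm_mult power2_eq_square)
  ultimately have A: "norm A = (1 / (pi * norm \<zeta>)) powr (DIM('a) / 2) * exp (- ((norm x)\<^sup>2 * Re (1 / \<zeta>)))"
    unfolding A_def norm_mult norm_gaussian_integral[OF b] by simp
  have "exp (- ((norm x)\<^sup>2 * Re (1 / \<zeta>))) \<le> 1"
    using Re_inverse_pos[OF \<zeta>] by simp
  then show "norm A \<le> (1 / (pi * norm \<zeta>)) powr (DIM('a) / 2)"
    unfolding A by (intro mult_left_le) auto
  have "Re (1 / \<zeta>) \<le> 1 / norm \<zeta>"
    using complex_Re_le_cmod[of "1 / \<zeta>"] by (simp add: norm_divide)
  then have "(norm x)\<^sup>2 * Re (1 / \<zeta>) \<le> (norm x)\<^sup>2 / norm \<zeta>"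
    using mult_left_mono[of "Re (1 / \<zeta>)" "1 / norm \<zeta>" "(norm x)\<^sup>2"] by simp
  then show "(1 / (pi * norm \<zeta>)) powr (DIM('a) / 2) * exp (- ((norm x)\<^sup>2 / norm \<zeta>)) \<le> norm A"
    unfolding A by (intro mult_left_mono) auto
qed

text \<open>
  For \<open>\<bar>t\<bar> \<le> r\<^sup>2\<close> the parameter \<open>\<zeta> = r\<^sup>2 + 4 i t\<close> has modulus between \<open>r\<^sup>2\<close> and \<open>5 r\<^sup>2\<close>:
  a packet of width \<open>r\<close> does not disperse before the time \<open>r\<^sup>2\<close>.
\<close>

lemma packet_focused:
  fixes x :: "'a::euclidean_space"
  assumes r: "r > 0" and t: "\<bar>t\<bar> \<le> r\<^sup>2" and x: "norm x \<le> r"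
  shows "(1 / (5 * pi)) powr (DIM('a) / 2) * exp (- 1) * r powr (- real DIM('a))
    \<le> norm (schroedinger t (gaussian_packet (of_real (r\<^sup>2))) x)"
proof -
  define \<zeta> where "\<zeta> = of_real (r\<^sup>2) + 4 * \<i> * complex_of_real t"
  have Re: "Re \<zeta> = r\<^sup>2" by (simp add: \<zeta>_def Re_power2)
  then have pos: "Re \<zeta> > 0" using r by simp
  have lo: "r\<^sup>2 \<le> norm \<zeta>" using complex_Re_le_cmod[of \<zeta>] Re by simp
  have "norm \<zeta> \<le> norm (of_real (r\<^sup>2) :: complex) + norm (4 * \<i> * complex_of_real t)"
    unfolding \<zeta>_def by (rule norm_triangle_ineq)
  also have "\<dots> \<le> 5 * r\<^sup>2" using t by (simp add: norm_mult norm_power)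
  finally have hi: "norm \<zeta> \<le> 5 * r\<^sup>2" .
  have "schroedinger t (gaussian_packet (of_real (r\<^sup>2))) x =
      gaussian_integral TYPE('a) (of_real (pi\<^sup>2) * \<zeta>) * exp (- of_real ((norm x)\<^sup>2) / \<zeta>)"
    using schroedinger_sum_packets[of "{()}" "\<lambda>_. of_real (r\<^sup>2)" t x] r
    by (simp add: \<zeta>_def eta_contract_eq Re_power2 del: of_real_power)
  then have "(1 / (pi * norm \<zeta>)) powr (DIM('a) / 2) * exp (- ((norm x)\<^sup>2 / norm \<zeta>))
      \<le> norm (schroedinger t (gaussian_packet (of_real (r\<^sup>2))) x)"
    using norm_evolved_packet(2)[OF pos, of x] by simp
  moreover have "(1 / (5 * pi)) powr (DIM('a) / 2) * r powr (- real DIM('a)) \<le> (1 / (pi * norm \<zeta>)) powr (DIM('a) / 2)"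
  proof -
    have "r powr (- real DIM('a)) = (1 / r\<^sup>2) powr (DIM('a) / 2)"
      using r by (simp add: powr_divide powr_minus_divide powr_numeral[symmetric] powr_powr del: powr_numeral)
    then have "(1 / (5 * pi)) powr (DIM('a) / 2) * r powr (- real DIM('a)) = (1 / (5 * pi) * (1 / r\<^sup>2)) powr (DIM('a) / 2)"
      by (simp add: powr_mult del: times_divide_eq_right times_divide_eq_left)
    also have "\<dots> \<le> (1 / (pi * norm \<zeta>)) powr (DIM('a) / 2)"
    proof (intro powr_mono2)
      have "0 < norm \<zeta>" using pos by auto
      then show "1 / (5 * pi) * (1 / r\<^sup>2) \<le> 1 / (pi * norm \<zeta>)"
        using r hi by (simp add: field_simps)
    qed (use r in auto)
    finally show ?thesis .
  qed
  moreover have "exp (- 1) \<le> exp (- ((norm x)\<^sup>2 / norm \<zeta>))"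
  proof -
    have "(norm x)\<^sup>2 \<le> r\<^sup>2" using x by (intro power_mono) auto
    then have "(norm x)\<^sup>2 / norm \<zeta> \<le> 1" using lo pos by (auto simp: divide_le_eq_1)
    then show ?thesis by simp
  qed
  ultimately show ?thesis
    by (smt (verit) exp_ge_zero mult.commute mult.left_commute mult_mono powr_ge_zero mult_nonneg_nonneg)
qed

lemma packet_L2:
  assumes r: "r > 0"
  shows "Lp_norm 2 (\<lambda>x::'a::euclidean_space. ennreal (norm (gaussian_packet (of_real (r\<^sup>2)) x)))
    \<le> ennreal (r powr (- (DIM('a) / 2)))"
proof -
  let ?z = "\<lambda>_::unit. complex_of_real (r\<^sup>2)"
  have "Lp_norm 2 (\<lambda>x::'a. ennreal (norm (\<Sum>k\<in>{()}. gaussian_packet (?z k) x)))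
    \<le> ennreal (sqrt (\<Sum>j\<in>{()}. \<Sum>k\<in>{()}. (1 / (pi * norm (?z j + cnj (?z k)))) powr (DIM('a) / 2)))"
    using r by (intro sum_packets_L2) (auto simp: Re_power2)
  also have "\<dots> \<le> ennreal (r powr (- (DIM('a) / 2)))"
  proof (intro ennreal_leI real_le_lsqrt)
    have n: "norm (complex_of_real (r\<^sup>2) + complex_of_real (r\<^sup>2)) = 2 * r\<^sup>2"
      by (metis abs_of_nonneg mult_2 norm_of_real of_real_add zero_le_power2 add_nonneg_nonneg)
    have "(1 / (pi * (2 * r\<^sup>2))) powr (DIM('a) / 2) \<le> (1 / r\<^sup>2) powr (DIM('a) / 2)"
    proof (intro powr_mono2 divide_left_mono)
      have "1 * r\<^sup>2 \<le> (pi * 2) * r\<^sup>2" using pi_gt3 by (intro mult_right_mono) auto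
      then show "r\<^sup>2 \<le> pi * (2 * r\<^sup>2)" by (simp add: mult.assoc)
    qed (use r in auto)
    also have "\<dots> = (r powr (- (DIM('a) / 2)))\<^sup>2"
      using r by (simp add: powr_divide powr_minus_divide powr_numeral[symmetric] powr_powr del: powr_numeral)
    finally show "(\<Sum>j\<in>{()}. \<Sum>k\<in>{()}. (1 / (pi * norm (?z j + cnj (?z k)))) powr (DIM('a) / 2))
        \<le> (r powr (- (DIM('a) / 2)))\<^sup>2"
      using n by simp
  qed auto
  finally show ?thesis by simp
qed

lemma packet_schwartz: "r > 0 \<Longrightarrow> schwartz (gaussian_packet (of_real (r\<^sup>2)) :: 'a::euclidean_space \<Rightarrow> complex)"
  using sum_packets_schwartz[of "{()}" "\<lambda>_. of_real (r\<^sup>2)", where 'a = 'a]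
  by (simp add: eta_contract_eq Re_power2 del: of_real_power)

section \<open>Packets focusing at well separated times\<close>

text \<open>
  The datum is the sum of the packets of width 1 that focus at the times \<open>\<tau> k = k L\<close>. At
  distance \<open>L - 1\<close> or more from its focusing time a packet is of size at most
  \<open>L powr (- 1 / 2)\<close>, and the inner product of two different packets obeys the same bound. With
  \<open>L\<close> of order \<open>N\<^sup>2\<close> the \<open>N\<^sup>2\<close> cross terms add up to at most \<open>N\<close> in the square of the norm, and
  near \<open>\<tau> k\<close> the \<open>N - 1\<close> other packets cannot cancel the focused one. The constant \<open>c\<close> is half
  the lower bound for a single focused packet.
\<close>

lemma packets_refocusing:
  obtains c where "0 < c"
    "\<And>N. 1 \<le> N \<Longrightarrow> \<exists>\<tau> u0 :: 'a::euclidean_space \<Rightarrow> complex. schwartz u0 \<and>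
       Lp_norm 2 (\<lambda>x. ennreal (norm (u0 x))) \<le> ennreal (sqrt (2 * real N)) \<and>
       (\<forall>i j. i \<noteq> j \<longrightarrow> 1 \<le> dist (\<tau> i) (\<tau> j)) \<and>
       (\<forall>k<N. \<forall>t\<in>ball (\<tau> k) 1. \<forall>x\<in>ball 0 1. c \<le> norm (schroedinger t u0 x))"
proof -
  define c where "c = (1 / (5 * pi)) powr (DIM('a) / 2) * exp (- 1) / 2"
  have c: "c > 0" by (simp add: c_def)
  show ?thesis
  proof (rule that[OF c])
    fix N :: nat assume N: "1 \<le> N"
    \<comment> \<open>The \<open>N\<close> other packets contribute at most \<open>N * (1 / (M * N)) = 1 / M \<le> c\<close>; the
      summand 2 ensures \<open>L \<ge> 4\<close>, so that a distance of \<open>L - 1\<close> is still comparable with \<open>L\<close>.\<close>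
    define M where "M = 1 / c + 2"
    have M: "M \<ge> 2" "1 / M \<le> c" using c by (auto simp: M_def field_simps)
    define L where "L = (M * N)\<^sup>2"
    have MN: "M * N \<ge> 2" using M N mult_mono[of 2 M 1 "real N"] by simp
    then have L: "L \<ge> 4" using power_mono[of 2 "M * N" 2] by (simp add: L_def)
    define \<tau> where "\<tau> k = L * real k" for k :: nat
    have sep: "L \<le> \<bar>\<tau> i - \<tau> j\<bar>" if "i \<noteq> j" for i j
    proof -
      have "1 \<le> \<bar>real i - real j\<bar>" using that by linarith
      then have "L * 1 \<le> L * \<bar>real i - real j\<bar>" using L by (intro mult_left_mono) auto
      then show ?thesis using L by (simp add: \<tau>_def right_diff_distrib[symmetric] abs_mult)
    qed
    define z where "z k = 1 - 4 * \<i> * of_real (\<tau> k)" for k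
    define u0 :: "'a \<Rightarrow> complex" where "u0 x = (\<Sum>k<N. gaussian_packet (z k) x)" for x
    have z: "Re (z k) > 0" for k by (simp add: z_def)
    have small: "(1 / (pi * s)) powr (DIM('a) / 2) \<le> 1 / (M * N)" if s: "L \<le> s" for s
    proof -
      have "1 * L \<le> pi * s" using s L pi_gt3 by (intro mult_mono) auto
      then have "(1 / (pi * s)) powr (DIM('a) / 2) \<le> (1 / L) powr (DIM('a) / 2)"
        using s L by (intro powr_mono2 divide_left_mono) auto
      \<comment> \<open>The decay exponent \<open>d / 2\<close> is at least 1/2, which makes the choice of \<open>L\<close> independent of the dimension.\<close>
      also have "\<dots> \<le> (1 / L) powr (1 / 2)"
        using L DIM_positive[where 'a = 'a] by (intro powr_mono') (auto simp: Suc_le_eq)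
      also have "\<dots> = 1 / (M * N)"
        using MN L by (simp add: powr_half_sqrt real_sqrt_divide) (simp add: L_def)
      finally show ?thesis .
    qed
    have norm_ge: "\<bar>Im w\<bar> \<le> norm w" for w by (rule abs_Im_le_cmod)
    have L2: "Lp_norm 2 (\<lambda>x. ennreal (norm (u0 x))) \<le> ennreal (sqrt (2 * real N))"
    proof -
      let ?a = "\<lambda>j k. (1 / (pi * norm (z j + cnj (z k)))) powr (DIM('a) / 2)"
      have a: "?a j k \<le> (if j = k then 1 else 1 / (M * N))" for j k
      proof (cases "j = k")
        case True
        have "norm (z j + cnj (z k)) = 2" using True by (simp add: z_def)
        moreover have "(1 / (pi * 2)) powr (DIM('a) / 2) \<le> 1"
          using pi_gt3 by (intro powr_le1) auto
        ultimately show ?thesis using True by simp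
      next
        case False
        have "L \<le> 4 * \<bar>\<tau> j - \<tau> k\<bar>" using sep[OF False] L by simp
        also have "\<dots> = \<bar>Im (z j + cnj (z k))\<bar>" by (simp add: z_def abs_if)
        also have "\<dots> \<le> norm (z j + cnj (z k))" by (rule norm_ge)
        finally show ?thesis using small False by simp
      qed
      have "(\<Sum>j<N. \<Sum>k<N. ?a j k) \<le> (\<Sum>j<N. \<Sum>k<N. (if j = k then 1 else 0) + 1 / (M * N))"
        using M by (intro sum_mono order_trans[OF a]) auto
      also have "\<dots> = N + N / M" using N by (simp add: sum.distrib distrib_left)
      also have "\<dots> \<le> 2 * N" using M N by (simp add: field_simps)
      finally show ?thesis
        unfolding u0_def using z
        by (intro order_trans[OF sum_packets_L2] ennreal_leI) auto
    qed
    have focus: "c \<le> norm (schroedinger t u0 x)" if k: "k < N" and t: "t \<in> ball (\<tau> k) 1" and x: "x \<in> ball 0 1" for k t x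
    proof -
      let ?\<zeta> = "\<lambda>k. z k + 4 * \<i> * of_real t"
      let ?A = "\<lambda>k. gaussian_integral TYPE('a) (of_real (pi\<^sup>2) * ?\<zeta> k) * exp (- of_real ((norm x)\<^sup>2) / ?\<zeta> k)"
      have t': "\<bar>t - \<tau> k\<bar> < 1" using t by (simp add: dist_real_def abs_minus_commute)
      have pos: "Re (?\<zeta> j) > 0" for j by (simp add: z_def)
      have \<zeta>: "?\<zeta> j = 1 + 4 * \<i> * of_real (t - \<tau> j)" for j by (simp add: z_def algebra_simps)
      have "schroedinger t u0 x = (\<Sum>j<N. ?A j)"
        unfolding u0_def by (rule schroedinger_sum_packets) (rule z)
      also have "\<dots> = ?A k + (\<Sum>j\<in>{..<N} - {k}. ?A j)"
        using k by (subst sum.remove[of _ k]) auto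
      finally have "norm (?A k) - norm (\<Sum>j\<in>{..<N} - {k}. ?A j) \<le> norm (schroedinger t u0 x)"
        by (simp add: norm_diff_ineq)
      moreover have "norm (\<Sum>j\<in>{..<N} - {k}. ?A j) \<le> c"
      proof -
        have "norm (?A j) \<le> 1 / (M * N)" if j: "j \<noteq> k" for j
        proof -
          have "\<bar>\<tau> j - \<tau> k\<bar> \<le> \<bar>t - \<tau> k\<bar> + \<bar>t - \<tau> j\<bar>"
            using abs_triangle_ineq4[of "t - \<tau> k" "t - \<tau> j"] by simp
          then have "L \<le> 4 * \<bar>t - \<tau> j\<bar>" using sep[OF j] t' L by simp
          also have "\<dots> = \<bar>Im (?\<zeta> j)\<bar>" unfolding \<zeta> by (simp add: abs_if)
          also have "\<dots> \<le> norm (?\<zeta> j)" by (rule norm_ge)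
          finally show ?thesis
            using norm_evolved_packet(1)[OF pos[of j], of x] small by (meson order_trans)
        qed
        then have "norm (\<Sum>j\<in>{..<N} - {k}. ?A j) \<le> real (card ({..<N} - {k})) * (1 / (M * N))"
          by (intro sum_norm_bound) auto
        also have "\<dots> \<le> real N * (1 / (M * N))"
          using M card_mono[of "{..<N}" "{..<N} - {k}"] by (intro mult_right_mono) auto
        also have "\<dots> = 1 / M" using N by simp
        finally show ?thesis using M by simp
      qed
      moreover have "2 * c \<le> norm (?A k)"
      proof -
        define n where "n = norm (?\<zeta> k)"
        have "1 \<le> n" using complex_Re_le_cmod[of "?\<zeta> k"] by (simp add: z_def n_def)
        moreover have "n \<le> 5"
          using t' norm_triangle_ineq[of 1 "4 * \<i> * complex_of_real (t - \<tau> k)"]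
          unfolding n_def \<zeta> by (simp add: norm_mult del: of_real_diff)
        moreover have "(norm x)\<^sup>2 \<le> 1" using x by (simp add: power_le_one)
        ultimately have "1 / (5 * pi) \<le> 1 / (pi * n)" "(norm x)\<^sup>2 / n \<le> 1"
          by (auto simp: field_simps)
        then have "(1 / (5 * pi)) powr (DIM('a) / 2) * exp (- 1)
            \<le> (1 / (pi * norm (?\<zeta> k))) powr (DIM('a) / 2) * exp (- ((norm x)\<^sup>2 / norm (?\<zeta> k)))"
          unfolding n_def by (intro mult_mono powr_mono2) auto
        then show ?thesis using norm_evolved_packet(2)[OF pos[of k], of x] by (simp add: c_def)
      qed
      ultimately show ?thesis by simp
    qed
    have "schwartz u0"
      unfolding u0_def using N z by (intro sum_packets_schwartz) (auto simp: lessThan_empty_iff)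
    then show "\<exists>\<tau> u0 :: 'a \<Rightarrow> complex. schwartz u0 \<and>
       Lp_norm 2 (\<lambda>x. ennreal (norm (u0 x))) \<le> ennreal (sqrt (2 * real N)) \<and>
       (\<forall>i j. i \<noteq> j \<longrightarrow> 1 \<le> dist (\<tau> i) (\<tau> j)) \<and>
       (\<forall>k<N. \<forall>t\<in>ball (\<tau> k) 1. \<forall>x\<in>ball 0 1. c \<le> norm (schroedinger t u0 x))"
      using L2 focus sep L by (intro exI[of _ \<tau>] exI[of _ u0]) (force simp: dist_real_def)
  qed
qed

section \<open>The conditions on the exponents\<close>

lemma powr_bounded_imp_nonpos:
  assumes "\<And>n::nat. n \<ge> N \<Longrightarrow> real n powr a \<le> B"
  shows "a \<le> 0"
proof (rule ccontr)
  assume "\<not> a \<le> 0"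
  then have "filterlim (\<lambda>n. real n powr a) at_top sequentially" by real_asymp
  then have "eventually (\<lambda>n. real n powr a > B) sequentially"
    by (simp add: filterlim_at_top_dense)
  then obtain n where "n \<ge> N" "real n powr a > B"
    by (metis eventually_sequentially nat_le_linear)
  then show False using assms[of n] by simp
qed

context
  fixes q1 q2 r1 r2 :: ennreal and C :: real
    and h :: "real \<Rightarrow> complex" and g :: "'a::euclidean_space \<Rightarrow> complex"
  assumes exponents: "1 \<le> q1" "1 \<le> q2" "1 \<le> r1" "1 \<le> r2" and C: "C > 0"
    and windows: "window h" "window g"
    and estimate: "\<And>u0 :: 'a \<Rightarrow> complex. schwartz u0 \<Longrightarrow>
           mixed_amalgam_norm q1 q2 h r1 r2 g (\<lambda>t. schroedinger t u0)
             \<le> ennreal C * Lp_norm 2 (\<lambda>x. ennreal (norm (u0 x)))"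
begin

text \<open>
  The packet of width \<open>r\<close> is of size \<open>r powr (- d)\<close> for \<open>\<bar>x\<bar> < r\<close> and \<open>\<bar>t\<bar> < r\<^sup>2\<close>, and its
  norm in \<open>L\<^sup>2\<close> is at most \<open>r powr (- d / 2)\<close>. The exponents \<open>a\<close> and \<open>b\<close> are those with
  which the amalgam norms in space and time see balls of these radii.
\<close>

lemma one_packet_test:
  assumes r: "r > 0" and K: "0 < K" "0 < K'"
    and inner: "\<And>c F. 0 \<le> c \<Longrightarrow> (\<And>x. x \<in> ball 0 r \<Longrightarrow> ennreal c \<le> F x) \<Longrightarrow>
       ennreal (K * c * r powr a) \<le> amalgam_norm r1 r2 g F"
    and outer: "\<And>c F. 0 \<le> c \<Longrightarrow> (\<And>t. t \<in> ball 0 (r\<^sup>2) \<Longrightarrow> ennreal c \<le> F t) \<Longrightarrow>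
       ennreal (K' * c * (r\<^sup>2) powr b) \<le> amalgam_norm q1 q2 h F"
  shows "r powr (a + 2 * b - DIM('a) / 2) \<le> C / (K * K' * ((1 / (5 * pi)) powr (DIM('a) / 2) * exp (- 1)))"
proof -
  let ?d = "real DIM('a)"
  define c where "c = (1 / (5 * pi)) powr (?d / 2) * exp (- 1)"
  have c: "c > 0" by (simp add: c_def)
  have "ennreal (K * (c * r powr (- ?d)) * r powr a) \<le>
      amalgam_norm r1 r2 g (\<lambda>x. ennreal (norm (schroedinger t (gaussian_packet (of_real (r\<^sup>2))) x)))"
    if "t \<in> ball 0 (r\<^sup>2)" for t
    using that c packet_focused[OF r, of t, where 'a = 'a]
    by (intro inner) (auto simp: c_def intro!: ennreal_leI)
  then have "ennreal (K' * (K * (c * r powr (- ?d)) * r powr a) * (r\<^sup>2) powr b)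
      \<le> mixed_amalgam_norm q1 q2 h r1 r2 g (\<lambda>t. schroedinger t (gaussian_packet (of_real (r\<^sup>2))))"
    unfolding mixed_amalgam_norm_def using c K(1) by (intro outer) auto
  also have "\<dots> \<le> ennreal C * ennreal (r powr (- (?d / 2)))"
    by (intro order_trans[OF estimate[OF packet_schwartz[OF r]]] mult_left_mono packet_L2 r) auto
  finally have "K' * (K * (c * r powr (- ?d)) * r powr a) * (r\<^sup>2) powr b \<le> C * r powr (- (?d / 2))"
    using C by (simp add: ennreal_mult[symmetric])
  moreover have "(r\<^sup>2) powr b = r powr (2 * b)"
    using r by (simp add: powr_numeral[symmetric] powr_powr del: powr_numeral)
  ultimately have "K * K' * c * (r powr (- ?d) * r powr a * r powr (2 * b) * r powr (?d / 2))
      \<le> C * (r powr (- (?d / 2)) * r powr (?d / 2))"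
    by (smt (verit) mult_right_mono powr_ge_zero mult_ac)
  also have "r powr (- (?d / 2)) * r powr (?d / 2) = 1"
    using r by (simp add: powr_add[symmetric])
  also have "r powr (- ?d) * r powr a * r powr (2 * b) * r powr (?d / 2) = r powr (a + 2 * b - ?d / 2)"
    by (simp only: powr_add[symmetric]) (simp add: algebra_simps)
  finally show ?thesis
    unfolding c_def[symmetric] using K c by (simp add: field_simps)
qed

text \<open>
  The limit of concentrated packets, \<open>r = 1 / n\<close> with \<open>n \<rightarrow> \<infinity>\<close>.
\<close>

lemma local_exponents: "DIM('a) / 2 \<le> 2 / enn2real q1 + DIM('a) / enn2real r1"
proof -
  obtain \<rho> K where K: "0 < \<rho>" "0 < K"
    "\<And>r c F. 0 < r \<Longrightarrow> r \<le> \<rho> \<Longrightarrow> 0 \<le> c \<Longrightarrow> (\<And>x. x \<in> ball 0 r \<Longrightarrow> ennreal c \<le> F x) \<Longrightarrow>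
       ennreal (K * c * r powr (DIM('a) / enn2real r1)) \<le> amalgam_norm r1 r2 g F"
    using amalgam_norm_ge_small_ball[OF windows(2) exponents(3,4)] by metis
  obtain \<rho>' K' where K': "0 < \<rho>'" "0 < K'"
    "\<And>r c F. 0 < r \<Longrightarrow> r \<le> \<rho>' \<Longrightarrow> 0 \<le> c \<Longrightarrow> (\<And>x. x \<in> ball 0 r \<Longrightarrow> ennreal c \<le> F x) \<Longrightarrow>
       ennreal (K' * c * r powr (DIM(real) / enn2real q1)) \<le> amalgam_norm q1 q2 h F"
    using amalgam_norm_ge_small_ball[OF windows(1) exponents(1,2)] by metis
  define N where "N = nat \<lceil>max (1 / \<rho>) (1 / \<rho>')\<rceil> + 1"
  let ?e = "DIM('a) / enn2real r1 + 2 * (DIM(real) / enn2real q1) - DIM('a) / 2"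
  have "- ?e \<le> 0"
  proof (rule powr_bounded_imp_nonpos[of N])
    fix n assume n: "n \<ge> N"
    define r where "r = 1 / real n"
    have "real n \<ge> 1" "real n \<ge> 1 / \<rho>" "real n \<ge> 1 / \<rho>'"
      using n by (auto simp: N_def) linarith+
    then have r: "0 < r" "r \<le> 1" "r \<le> \<rho>" "r \<le> \<rho>'" using K(1) K'(1) by (auto simp: r_def field_simps)
    then have r2: "0 < r\<^sup>2" "r\<^sup>2 \<le> \<rho>'" by (auto intro: order_trans[of _ r] simp: power2_eq_square mult_left_le)
    have "real n powr - e = r powr e" for e
      using r(1) by (simp add: r_def powr_divide powr_minus_divide)
    then show "real n powr - ?e \<le> C / (K * K' * ((1 / (5 * pi)) powr (DIM('a) / 2) * exp (- 1)))"
      using one_packet_test[OF r(1) K(2) K'(2) K(3)[OF r(1,3)] K'(3)[OF r2]] by metis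
  qed
  then show ?thesis by simp
qed

text \<open>
  The limit of spread out packets, \<open>r = n \<rightarrow> \<infinity>\<close>.
\<close>

lemma global_exponents: "2 / enn2real q2 + DIM('a) / enn2real r2 \<le> DIM('a) / 2"
proof -
  obtain K where K: "0 < K"
    "\<And>r c F. 1 \<le> r \<Longrightarrow> 0 \<le> c \<Longrightarrow> (\<And>x. x \<in> ball 0 r \<Longrightarrow> ennreal c \<le> F x) \<Longrightarrow>
       ennreal (K * c * r powr (DIM('a) / enn2real r2)) \<le> amalgam_norm r1 r2 g F"
    using amalgam_norm_ge_large_ball[OF windows(2) exponents(3,4)] by metis
  obtain K' where K': "0 < K'"
    "\<And>r c F. 1 \<le> r \<Longrightarrow> 0 \<le> c \<Longrightarrow> (\<And>x. x \<in> ball 0 r \<Longrightarrow> ennreal c \<le> F x) \<Longrightarrow>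
       ennreal (K' * c * r powr (DIM(real) / enn2real q2)) \<le> amalgam_norm q1 q2 h F"
    using amalgam_norm_ge_large_ball[OF windows(1) exponents(1,2)] by metis
  have "DIM('a) / enn2real r2 + 2 * (DIM(real) / enn2real q2) - DIM('a) / 2 \<le> 0"
  proof (rule powr_bounded_imp_nonpos[of 1])
    fix n :: nat assume "n \<ge> 1"
    then have r: "0 < real n" "1 \<le> real n" "1 \<le> (real n)\<^sup>2" by auto
    show "real n powr (DIM('a) / enn2real r2 + 2 * (DIM(real) / enn2real q2) - DIM('a) / 2)
        \<le> C / (K * K' * ((1 / (5 * pi)) powr (DIM('a) / 2) * exp (- 1)))"
      by (rule one_packet_test[OF r(1) K(1) K'(1) K(2)[OF r(2)] K'(2)[OF r(3)]])
  qed
  then show ?thesis by simp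
qed

text \<open>
  The sum of \<open>N\<close> refocusing packets has norm \<open>O(sqrt N)\<close> in \<open>L\<^sup>2\<close>, while the norm in time
  grows at least like \<open>N powr (1 / q2)\<close>.
\<close>

lemma global_time_exponent: "1 / enn2real q2 \<le> 1 / 2"
proof -
  obtain c where c: "0 < c"
    "\<And>N. 1 \<le> N \<Longrightarrow> \<exists>\<tau> u0 :: 'a \<Rightarrow> complex. schwartz u0 \<and>
       Lp_norm 2 (\<lambda>x. ennreal (norm (u0 x))) \<le> ennreal (sqrt (2 * real N)) \<and>
       (\<forall>i j. i \<noteq> j \<longrightarrow> 1 \<le> dist (\<tau> i) (\<tau> j)) \<and>
       (\<forall>k<N. \<forall>t\<in>ball (\<tau> k) 1. \<forall>x\<in>ball 0 1. c \<le> norm (schroedinger t u0 x))"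
    using packets_refocusing by metis
  obtain K where K: "0 < K"
    "\<And>r c F. 1 \<le> r \<Longrightarrow> 0 \<le> c \<Longrightarrow> (\<And>x. x \<in> ball 0 r \<Longrightarrow> ennreal c \<le> F x) \<Longrightarrow>
       ennreal (K * c * r powr (DIM('a) / enn2real r2)) \<le> amalgam_norm r1 r2 g F"
    using amalgam_norm_ge_large_ball[OF windows(2) exponents(3,4)] by metis
  obtain K' where K': "0 < K'"
    "\<And>I a c F. finite I \<Longrightarrow> I \<noteq> {} \<Longrightarrow> (\<And>i j. i \<in> I \<Longrightarrow> j \<in> I \<Longrightarrow> i \<noteq> j \<Longrightarrow> 1 \<le> dist (a i) (a j)) \<Longrightarrow> 0 \<le> c \<Longrightarrow>
       (\<And>i x. i \<in> I \<Longrightarrow> x \<in> ball (a i) 1 \<Longrightarrow> ennreal c \<le> F x) \<Longrightarrow>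
       ennreal (K' * c * card (I::nat set) powr (1 / enn2real q2)) \<le> amalgam_norm q1 q2 h F"
    using amalgam_norm_ge_separated_balls[OF windows(1) exponents(1,2)] by blast
  have "1 / enn2real q2 - 1 / 2 \<le> 0"
  proof (rule powr_bounded_imp_nonpos[of 1 _ "C * sqrt 2 / (K * K' * c)"])
    fix N :: nat assume N: "N \<ge> 1"
    define X Y where "X = real N powr (1 / enn2real q2)" and "Y = real N powr (1 / 2)"
    have Y: "Y > 0" using N by (simp add: Y_def)
    obtain \<tau> and u0 :: "'a \<Rightarrow> complex" where u0: "schwartz u0"
      "Lp_norm 2 (\<lambda>x. ennreal (norm (u0 x))) \<le> ennreal (sqrt (2 * real N))"
      "\<And>i j. i \<noteq> j \<Longrightarrow> 1 \<le> dist (\<tau> i) (\<tau> j)"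
      "\<And>k t x. k < N \<Longrightarrow> t \<in> ball (\<tau> k) 1 \<Longrightarrow> x \<in> ball 0 1 \<Longrightarrow> c \<le> norm (schroedinger t u0 x)"
      using c(2)[OF N] by blast
    have "ennreal (K * c * 1 powr (DIM('a) / enn2real r2)) \<le>
        amalgam_norm r1 r2 g (\<lambda>x. ennreal (norm (schroedinger t u0 x)))"
      if "k < N" "t \<in> ball (\<tau> k) 1" for k t
      using that c(1) u0(4) by (intro K(2) ennreal_leI) auto
    then have "ennreal (K' * (K * c) * card {..<N} powr (1 / enn2real q2))
        \<le> mixed_amalgam_norm q1 q2 h r1 r2 g (\<lambda>t. schroedinger t u0)"
      unfolding mixed_amalgam_norm_def using c(1) K(1) u0(3) N
      by (intro K'(2)[where a = \<tau>]) (auto simp: lessThan_empty_iff)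
    also have "\<dots> \<le> ennreal C * ennreal (sqrt (2 * real N))"
      by (intro order_trans[OF estimate[OF u0(1)]] mult_left_mono u0(2)) auto
    finally have "K' * (K * c) * N powr (1 / enn2real q2) \<le> C * sqrt (2 * real N)"
      using C by (simp add: ennreal_mult[symmetric])
    also have "\<dots> = C * sqrt 2 * N powr (1 / 2)"
      by (simp add: real_sqrt_mult powr_half_sqrt)
    finally have "X * (K * K' * c) \<le> C * sqrt 2 * Y"
      by (simp add: X_def Y_def mult_ac)
    then have "X / Y \<le> C * sqrt 2 / (K * K' * c)"
      using Y K(1) K'(1) c(1) by (simp add: frac_le_eq divide_simps mult_ac)
    then show "real N powr (1 / enn2real q2 - 1 / 2) \<le> C * sqrt 2 / (K * K' * c)"
      by (simp only: powr_diff X_def Y_def)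
  qed
  then show ?thesis by simp
qed

end

lemma of_nat_divide_ennreal:
  assumes "1 \<le> p"
  shows "of_nat n / p = ennreal (real n / enn2real p)"
proof (cases p)
  case (real a)
  then have "a > 0" using assms by (auto simp: less_le_trans ennreal_1[symmetric] simp del: ennreal_1)
  then show ?thesis using real by (simp add: divide_ennreal ennreal_of_nat_eq_real_of_nat)
qed simp

lemma two_le_ennreal:
  assumes "1 \<le> p" "1 / enn2real p \<le> 1 / 2"
  shows "2 \<le> p"
proof (cases p)
  case (real a)
  then have "a \<ge> 1" using assms(1) by (simp add: ennreal_1[symmetric] del: ennreal_1)
  then have "ennreal 2 \<le> ennreal a" using assms(2) real by (intro ennreal_leI) (simp add: field_simps)
  then show ?thesis using real by simp
qed simp

theorem proposition5p4:
  fixes q1 q2 r1 r2 :: ennreal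
    and C :: real
    and h :: "real \<Rightarrow> complex"
    and g :: "real ^ 'd \<Rightarrow> complex"
  assumes "1 \<le> q1" and "1 \<le> q2" and "1 \<le> r1" and "1 \<le> r2"
    and "C > 0"
    and "window h" and "window g"
    and "\<And>u0 :: real ^ 'd \<Rightarrow> complex. schwartz u0 \<Longrightarrow>
           mixed_amalgam_norm q1 q2 h r1 r2 g (\<lambda>t. schroedinger t u0)
             \<le> ennreal C * Lp_norm 2 (\<lambda>x. ennreal (norm (u0 x)))"
  shows "2 / q1 + of_nat CARD('d) / r1 \<ge> of_nat CARD('d) / 2
       \<and> 2 / q2 + of_nat CARD('d) / r2 \<le> of_nat CARD('d) / 2
       \<and> r2 \<ge> 2 \<and> q2 \<ge> 2"
proof -
  let ?d = "CARD('d)"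
  have loc: "?d / 2 \<le> 2 / enn2real q1 + ?d / enn2real r1"
    using local_exponents[OF assms] by simp
  have glob: "2 / enn2real q2 + ?d / enn2real r2 \<le> ?d / 2"
    using global_exponents[OF assms] by simp
  have "1 / enn2real q2 \<le> 1 / 2"
    using global_time_exponent[OF assms] .
  then have q2: "2 \<le> q2" by (rule two_le_ennreal[OF assms(2)])
  have "0 \<le> 2 / enn2real q2" by simp
  with glob have "?d / enn2real r2 \<le> ?d / 2" by linarith
  then have "?d * (1 / enn2real r2) \<le> ?d * (1 / 2)" by simp
  then have "1 / enn2real r2 \<le> 1 / 2"
    using zero_less_card_finite[where 'a = 'd] by (simp only: mult_le_cancel_left_pos of_nat_0_less_iff)
  then have r2: "2 \<le> r2" by (rule two_le_ennreal[OF assms(4)])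
  have two: "2 / p = ennreal (2 / enn2real p)" if "1 \<le> p" for p
    using of_nat_divide_ennreal[OF that, of 2] by simp
  have half: "of_nat ?d / 2 = ennreal (?d / 2)"
    using of_nat_divide_ennreal[of 2 ?d] by simp
  show ?thesis
    using loc glob q2 r2
    by (simp add: two half assms of_nat_divide_ennreal ennreal_plus[symmetric] ennreal_leI del: ennreal_plus)
qed

end
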